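(* Let $\mathcal{D}$ be a holomorphic distribution of complex hyperplanes in $\mathbb{C}^3$ (i.e., locally $\mathcal{D}=\ker\omega$ for a nowhere-vanishing holomorphic $1$-form $\omega$). Suppose that for every point $p\in\mathbb{C}^3$ and every neighborhood $U$ of $p$, there exists a point $q\in U$ that cannot be reached from $p$ by a holomorphic curve in $U$ admissible for $\mathcal{D}$. Then $\mathcal{D}$ is integrable.
   Context: A holomorphic curve $\gamma$ (a holomorphic map from a domain in $\mathbb{C}$ into $\mathbb{C}^3$) is called admissible for $\mathcal{D}$ if at each point its complex tangent vector lies in the corresponding plane of $\mathcal{D}$, i.e., $\omega(\gamma'(t))=0$ for all $t$. A point $q$ is reachable from $p$ if there is an admissible holomorphic curve passing through both $p$ and $q$. The distribution $\mathcal{D}$ is integrable if $\mathbb{C}^3$ is locally foliated by complex hypersurfaces whose tangent planes coincide with the planes of $\mathcal{D}$. *)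

theory Defs
  imports "HOL-Analysis.Analysis"
begin

definition holo3 :: "(complex^3 \<Rightarrow> complex) \<Rightarrow> (complex^3) set \<Rightarrow> bool" where
  "holo3 f S \<longleftrightarrow> open S \<and>
     (\<forall>x\<in>S. \<exists>L. (f has_derivative L) (at x) \<and> (\<forall>(c::complex) v. L (c *s v) = c * L v))"

definition pair3 :: "complex^3 \<Rightarrow> complex^3 \<Rightarrow> complex" where
  "pair3 w v = (\<Sum>i\<in>UNIV. w $ i * v $ i)"

definition hol_hyperplane_distribution :: "(complex^3 \<Rightarrow> (complex^3) set) \<Rightarrow> bool" where
  "hol_hyperplane_distribution D \<longleftrightarrow>
     (\<forall>p. \<exists>V \<omega>. open V \<and> p \<in> V \<and> (\<forall>i. holo3 (\<lambda>x. \<omega> x $ i) V) \<and>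
            (\<forall>x\<in>V. \<omega> x \<noteq> 0 \<and> D x = {v. pair3 (\<omega> x) v = 0}))"

definition hol_curve :: "(complex \<Rightarrow> complex^3) \<Rightarrow> complex set \<Rightarrow> bool" where
  "hol_curve \<gamma> \<Omega> \<longleftrightarrow> open \<Omega> \<and> connected \<Omega> \<and> \<Omega> \<noteq> {} \<and>
     (\<forall>i. (\<lambda>t. \<gamma> t $ i) holomorphic_on \<Omega>)"

definition curve_deriv :: "(complex \<Rightarrow> complex^3) \<Rightarrow> complex \<Rightarrow> complex^3" where
  "curve_deriv \<gamma> t = (\<chi> i. deriv (\<lambda>s. \<gamma> s $ i) t)"

definition admissible :: "(complex^3 \<Rightarrow> (complex^3) set) \<Rightarrow> (complex \<Rightarrow> complex^3) \<Rightarrow> complex set \<Rightarrow> bool" where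
  "admissible D \<gamma> \<Omega> \<longleftrightarrow> hol_curve \<gamma> \<Omega> \<and> (\<forall>t\<in>\<Omega>. curve_deriv \<gamma> t \<in> D (\<gamma> t))"

definition reachable_in :: "(complex^3 \<Rightarrow> (complex^3) set) \<Rightarrow> (complex^3) set \<Rightarrow> complex^3 \<Rightarrow> complex^3 \<Rightarrow> bool" where
  "reachable_in D U p q \<longleftrightarrow>
     (\<exists>\<gamma> \<Omega>. admissible D \<gamma> \<Omega> \<and> \<gamma> ` \<Omega> \<subseteq> U \<and> p \<in> \<gamma> ` \<Omega> \<and> q \<in> \<gamma> ` \<Omega>)"

text \<open>Integrability: C^3 is locally foliated by complex hypersurfaces tangent to D, i.e.
near each point there is a holomorphic submersion F (whose level sets are the leaves)
with D x = ker dF_x.\<close>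

definition integrable_distribution :: "(complex^3 \<Rightarrow> (complex^3) set) \<Rightarrow> bool" where
  "integrable_distribution D \<longleftrightarrow>
     (\<forall>p. \<exists>V F. open V \<and> p \<in> V \<and> holo3 F V \<and>
        (\<forall>x\<in>V. \<exists>L. (F has_derivative L) (at x) \<and> (\<exists>v. L v \<noteq> 0) \<and> D x = {v. L v = 0}))"

end

theory Submission
  imports Defs "HOL-Complex_Analysis.Cauchy_Integral_Formula"
begin

text \<open>
  Near a point, and up to a permutation of the coordinates, the distribution is the kernel of
  \<open>dz - a dx - b dy\<close>. Solving the holomorphic differential equation \<open>\<partial>z/\<partial>y = b\<close> straightens
  the admissible direction lying over the \<open>y\<close>-axis and turns the form into a multiple of
  \<open>dz - f dx\<close>. If \<open>f\<close> does not depend on \<open>y\<close> near the point, a second differential equation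
  \<open>dz/dx = f\<close> yields a first integral. Otherwise \<open>\<partial>f/\<partial>y \<noteq> 0\<close> at some nearby point, around which
  \<open>(x, f, z)\<close> are Darboux coordinates; there every point of a small polydisc \<open>U\<close> is joined to
  the centre by an explicit admissible curve inside \<open>U\<close>, contradicting the hypothesis.
\<close>

section \<open>Holomorphic functions of three variables\<close>

text \<open>The obstacle is that reachability asks for a single holomorphic curve. Concatenating
  short flow lines, as in the Chow-Rashevskii argument, gives only a piecewise curve, so the
  connecting curve must come from one formula; it is built from entire functions, since in contact
  form the admissibility condition is a plain quadrature. The curve must also stay inside the
  neighbourhood. Here the shape of the hypothesis helps: refuting it takes just one point and one
  neighbourhood all of whose points are reachable within it, so this neighbourhood may be a polydisc
  in adapted coordinates rather than an arbitrary open set. Its centre is only close to the given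
  point, because \<open>D2 f\<close> may vanish at that point without vanishing identically around
  it; the hypothesis is therefore used away from the point where the foliation is sought. The
  dichotomy on \<open>D2 f\<close> is the Frobenius condition: the exterior product of dz - f dx
  with its differential is \<open>D2 f\<close> times the volume form dx dy dz.\<close>

definition D1 :: "(complex \<times> 'a \<Rightarrow> complex) \<Rightarrow> complex \<times> 'a \<Rightarrow> complex" where
  "D1 f p = deriv (\<lambda>t. f (t, snd p)) (fst p)"

definition D2 :: "(complex \<times> complex \<times> complex \<Rightarrow> complex) \<Rightarrow> complex \<times> complex \<times> complex \<Rightarrow> complex" where
  "D2 f p = deriv (\<lambda>t. f (fst p, t, snd (snd p))) (fst (snd p))"

definition D3 :: "(complex \<times> complex \<times> complex \<Rightarrow> complex) \<Rightarrow> complex \<times> complex \<times> complex \<Rightarrow> complex" where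
  "D3 f p = deriv (\<lambda>t. f (fst p, fst (snd p), t)) (snd (snd p))"

text \<open>Joint complex differentiability on a product of three copies of the plane: the explicit
  coefficients encode complex linearity of the derivative. With tuples, freezing a variable or
  inserting functions for the coordinates is plain pairing.\<close>

definition hol3 :: "(complex \<times> complex \<times> complex \<Rightarrow> complex) \<Rightarrow> (complex \<times> complex \<times> complex) set \<Rightarrow> bool" where
  "hol3 f S \<longleftrightarrow> open S \<and>
     (\<forall>p\<in>S. \<exists>a b c. (f has_derivative (\<lambda>(u, v, w). a * u + b * v + c * w)) (at p))"

lemma hol3_open: "hol3 f S \<Longrightarrow> open S"
  by (simp add: hol3_def)

lemma hol3_subset: "hol3 f S \<Longrightarrow> T \<subseteq> S \<Longrightarrow> open T \<Longrightarrow> hol3 f T"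
  by (auto simp: hol3_def)

lemma hol3_continuous: "hol3 f S \<Longrightarrow> continuous_on S f"
  unfolding hol3_def
  by (meson continuous_at_imp_continuous_on has_derivative_continuous)

lemma has_derivative_partials:
  assumes "(f has_derivative (\<lambda>(u, v, w). a * u + b * v + c * w)) (at (x, y, z))"
  shows "((\<lambda>t. f (t, y, z)) has_field_derivative a) (at x)"
    and "((\<lambda>t. f (x, t, z)) has_field_derivative b) (at y)"
    and "((\<lambda>t. f (x, y, t)) has_field_derivative c) (at z)"
proof -
  have "((\<lambda>t. f (t, y, z)) has_derivative (\<lambda>h. (\<lambda>(u, v, w). a * u + b * v + c * w) (h, 0, 0))) (at x)"
    by (rule has_derivative_compose[where g=f and f="\<lambda>t. (t, y, z)"])
       (use assms in \<open>auto intro!: derivative_eq_intros simp: zero_prod_def\<close>)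
  then show "((\<lambda>t. f (t, y, z)) has_field_derivative a) (at x)"
    by (simp add: has_field_derivative_def)
  have "((\<lambda>t. f (x, t, z)) has_derivative (\<lambda>h. (\<lambda>(u, v, w). a * u + b * v + c * w) (0, h, 0))) (at y)"
    by (rule has_derivative_compose[where g=f and f="\<lambda>t. (x, t, z)"])
       (use assms in \<open>auto intro!: derivative_eq_intros simp: zero_prod_def\<close>)
  then show "((\<lambda>t. f (x, t, z)) has_field_derivative b) (at y)"
    by (simp add: has_field_derivative_def)
  have "((\<lambda>t. f (x, y, t)) has_derivative (\<lambda>h. (\<lambda>(u, v, w). a * u + b * v + c * w) (0, 0, h))) (at z)"
    by (rule has_derivative_compose[where g=f and f="\<lambda>t. (x, y, t)"])
       (use assms in \<open>auto intro!: derivative_eq_intros simp: zero_prod_def\<close>)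
  then show "((\<lambda>t. f (x, y, t)) has_field_derivative c) (at z)"
    by (simp add: has_field_derivative_def)
qed

lemma partials_eqI:
  assumes "(f has_derivative (\<lambda>(u, v, w). a * u + b * v + c * w)) (at p)"
  shows "D1 f p = a" "D2 f p = b" "D3 f p = c"
  using has_derivative_partials[of f a b c "fst p" "fst (snd p)" "snd (snd p)"] assms
  by (auto simp: D1_def D2_def D3_def intro!: DERIV_imp_deriv)

lemma hol3_has_derivative:
  assumes "hol3 f S" "p \<in> S"
  shows "(f has_derivative (\<lambda>(u, v, w). D1 f p * u + D2 f p * v + D3 f p * w)) (at p)"
proof -
  obtain a b c where d: "(f has_derivative (\<lambda>(u, v, w). a * u + b * v + c * w)) (at p)"
    using assms unfolding hol3_def by blast
  show ?thesis
    using d by (simp only: partials_eqI[OF d])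
qed

lemma hol3_partials:
  assumes "hol3 f S" "(x, y, z) \<in> S"
  shows "((\<lambda>t. f (t, y, z)) has_field_derivative D1 f (x, y, z)) (at x)"
    and "((\<lambda>t. f (x, t, z)) has_field_derivative D2 f (x, y, z)) (at y)"
    and "((\<lambda>t. f (x, y, t)) has_field_derivative D3 f (x, y, z)) (at z)"
  using has_derivative_partials[OF hol3_has_derivative[OF assms]] by auto

lemma hol3_chain:
  assumes f: "hol3 f S" and p: "(x t, y t, z t) \<in> S"
    and "(x has_field_derivative x') (at t)" "(y has_field_derivative y') (at t)"
      "(z has_field_derivative z') (at t)"
  shows "((\<lambda>t. f (x t, y t, z t)) has_field_derivative
     (D1 f (x t, y t, z t) * x' + D2 f (x t, y t, z t) * y' + D3 f (x t, y t, z t) * z')) (at t)"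
proof -
  have "((\<lambda>t. (x t, y t, z t)) has_derivative (\<lambda>h. (x' * h, y' * h, z' * h))) (at t)"
    using assms(3-5) by (auto simp: has_field_derivative_def intro!: derivative_eq_intros)
  from has_derivative_compose[OF this hol3_has_derivative[OF f p]]
  show ?thesis
    unfolding has_field_derivative_def
    by (rule has_derivative_eq_rhs) (simp add: fun_eq_iff algebra_simps)
qed

lemma hol3_comp_has_derivative:
  assumes f: "hol3 f S" and p: "(g1 p, g2 p, g3 p) \<in> S"
    and "(g1 has_derivative (\<lambda>(u, v, w). a1 * u + b1 * v + c1 * w)) (at p)"
        "(g2 has_derivative (\<lambda>(u, v, w). a2 * u + b2 * v + c2 * w)) (at p)"
        "(g3 has_derivative (\<lambda>(u, v, w). a3 * u + b3 * v + c3 * w)) (at p)"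
  shows "((\<lambda>p. f (g1 p, g2 p, g3 p)) has_derivative
     (\<lambda>(u, v, w). 
        (let q = (g1 p, g2 p, g3 p) in
          (D1 f q * a1 + D2 f q * a2 + D3 f q * a3) * u
        + (D1 f q * b1 + D2 f q * b2 + D3 f q * b3) * v
        + (D1 f q * c1 + D2 f q * c2 + D3 f q * c3) * w))) (at p)"
proof -
  have "((\<lambda>p. (g1 p, g2 p, g3 p)) has_derivative (\<lambda>h. ((\<lambda>(u, v, w). a1 * u + b1 * v + c1 * w) h,
     (\<lambda>(u, v, w). a2 * u + b2 * v + c2 * w) h, (\<lambda>(u, v, w). a3 * u + b3 * v + c3 * w) h))) (at p)"
    by (intro has_derivative_Pair assms)
  from has_derivative_compose[OF this hol3_has_derivative[OF f p]]
  show ?thesis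
    by (rule has_derivative_eq_rhs) (auto simp: fun_eq_iff algebra_simps Let_def)
qed

lemma hol3_comp:
  assumes f: "hol3 f S" and g: "hol3 g1 T" "hol3 g2 T" "hol3 g3 T"
    and sub: "\<And>p. p \<in> T \<Longrightarrow> (g1 p, g2 p, g3 p) \<in> S"
  shows "hol3 (\<lambda>p. f (g1 p, g2 p, g3 p)) T"
  unfolding hol3_def
proof (intro conjI ballI)
  show "open T" using g(1) by (rule hol3_open)
  fix p assume p: "p \<in> T"
  from hol3_comp_has_derivative[OF f sub[OF p] hol3_has_derivative[OF g(1) p]
     hol3_has_derivative[OF g(2) p] hol3_has_derivative[OF g(3) p]]
  show "\<exists>a b c. ((\<lambda>p. f (g1 p, g2 p, g3 p)) has_derivative (\<lambda>(u, v, w). a * u + b * v + c * w)) (at p)"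
    unfolding Let_def by blast
qed

lemma hol3I:
  assumes "open S"
    and "\<And>p. p \<in> S \<Longrightarrow> (f has_derivative (\<lambda>(u, v, w). a p * u + b p * v + c p * w)) (at p)"
  shows "hol3 f S"
  using assms unfolding hol3_def by blast

lemma hol3_const: "open S \<Longrightarrow> hol3 (\<lambda>p. c) S"
  by (rule hol3I[where a="\<lambda>_. 0" and b="\<lambda>_. 0" and c="\<lambda>_. 0"]) (simp_all add: split_beta')

lemma hol3_fst: "open S \<Longrightarrow> hol3 fst S"
  by (rule hol3I[where a="\<lambda>_. 1" and b="\<lambda>_. 0" and c="\<lambda>_. 0"])
     (auto intro!: derivative_eq_intros simp: split_beta')

lemma hol3_snd: "open S \<Longrightarrow> hol3 (\<lambda>p. fst (snd p)) S"
  by (rule hol3I[where a="\<lambda>_. 0" and b="\<lambda>_. 1" and c="\<lambda>_. 0"])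
     (auto intro!: derivative_eq_intros simp: split_beta')

lemma hol3_thd: "open S \<Longrightarrow> hol3 (\<lambda>p. snd (snd p)) S"
  by (rule hol3I[where a="\<lambda>_. 0" and b="\<lambda>_. 0" and c="\<lambda>_. 1"])
     (auto intro!: derivative_eq_intros simp: split_beta')

lemma hol3_add:
  assumes "hol3 f S" "hol3 g S"
  shows "hol3 (\<lambda>p. f p + g p) S"
proof (rule hol3I)
  fix p assume "p \<in> S"
  with assms show "((\<lambda>p. f p + g p) has_derivative (\<lambda>(u, v, w).
      (D1 f p + D1 g p) * u + (D2 f p + D2 g p) * v + (D3 f p + D3 g p) * w)) (at p)"
    by (intro has_derivative_add[OF hol3_has_derivative hol3_has_derivative, THEN has_derivative_eq_rhs])
       (auto simp: fun_eq_iff algebra_simps)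
qed (rule hol3_open[OF assms(1)])

lemma hol3_mult:
  assumes "hol3 f S" "hol3 g S"
  shows "hol3 (\<lambda>p. f p * g p) S"
proof (rule hol3I)
  fix p assume "p \<in> S"
  with assms show "((\<lambda>p. f p * g p) has_derivative (\<lambda>(u, v, w).
      (f p * D1 g p + D1 f p * g p) * u + (f p * D2 g p + D2 f p * g p) * v
      + (f p * D3 g p + D3 f p * g p) * w)) (at p)"
    by (intro has_derivative_mult[OF hol3_has_derivative hol3_has_derivative, THEN has_derivative_eq_rhs])
       (auto simp: fun_eq_iff algebra_simps)
qed (rule hol3_open[OF assms(1)])

lemma hol3_inverse:
  assumes "hol3 f S" "\<And>p. p \<in> S \<Longrightarrow> f p \<noteq> 0"
  shows "hol3 (\<lambda>p. inverse (f p)) S"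
proof (rule hol3I)
  fix p assume "p \<in> S"
  with assms show "((\<lambda>p. inverse (f p)) has_derivative (\<lambda>(u, v, w).
      - (inverse (f p) * D1 f p * inverse (f p)) * u + - (inverse (f p) * D2 f p * inverse (f p)) * v
      + - (inverse (f p) * D3 f p * inverse (f p)) * w)) (at p)"
    by (intro Deriv.has_derivative_inverse[OF _ hol3_has_derivative, THEN has_derivative_eq_rhs])
       (auto simp: fun_eq_iff algebra_simps)
qed (rule hol3_open[OF assms(1)])

lemma hol3_diff: "hol3 f S \<Longrightarrow> hol3 g S \<Longrightarrow> hol3 (\<lambda>p. f p - g p) S"
  using hol3_add[of f S "\<lambda>p. (-1) * g p"] hol3_mult[OF hol3_const[of S "-1"], of g] hol3_open[of g]
  by simp

lemma hol3_divide:
  "hol3 f S \<Longrightarrow> hol3 g S \<Longrightarrow> (\<And>p. p \<in> S \<Longrightarrow> g p \<noteq> 0) \<Longrightarrow> hol3 (\<lambda>p. f p / g p) S"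
  using hol3_mult[OF _ hol3_inverse[of g S]] by (simp add: divide_inverse)

lemmas hol3_intros = hol3_const hol3_fst hol3_snd hol3_thd hol3_add hol3_diff hol3_mult hol3_divide

section \<open>Cauchy estimates and regularity of the partial derivatives\<close>

lemma open_polydisc:
  fixes a b c :: complex
  assumes "open S" "(a, b, c) \<in> S"
  obtains r where "r > 0" "cball a r \<times> cball b r \<times> cball c r \<subseteq> S"
proof -
  obtain A V where "open A" "open V" "a \<in> A" "(b, c) \<in> V" and AV: "A \<times> V \<subseteq> S"
    using assms by (rule open_prod_elim) auto
  moreover obtain B C where "open B" "open C" "b \<in> B" "c \<in> C" and BC: "B \<times> C \<subseteq> V"
    using \<open>open V\<close> \<open>(b, c) \<in> V\<close> by (rule open_prod_elim) auto
  moreover obtain r1 where "r1 > 0" "cball a r1 \<subseteq> A"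
    using calculation open_contains_cball by blast
  moreover obtain r2 where "r2 > 0" "cball b r2 \<subseteq> B"
    using calculation open_contains_cball by blast
  moreover obtain r3 where "r3 > 0" "cball c r3 \<subseteq> C"
    using calculation open_contains_cball by blast
  moreover define r where "r = min r1 (min r2 r3)"
  ultimately have "r > 0" "cball a r \<subseteq> A" "cball b r \<subseteq> B" "cball c r \<subseteq> C"
    by (auto simp: subset_eq)
  then show ?thesis
    using that[of r] AV BC by blast
qed

text \<open>Cauchy's inequality bounds the second derivative in the first variable uniformly in the
  parameter, and Taylor's formula then bounds the error of the quotient by
  \<open>K * norm (h n)\<close>. So \<open>D1 g\<close> inherits from the quotients whatever
  survives uniform limits. The parameter space is arbitrary, so it can hold the two remaining
  coordinates.\<close>

lemma uniform_difference_quotient: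
  fixes g :: "complex \<times> 'a::metric_space \<Rightarrow> complex"
  assumes "open S" and cont: "continuous_on S g"
    and dif: "\<And>x w. (x, w) \<in> S \<Longrightarrow> (\<lambda>t. g (t, w)) field_differentiable (at x)"
    and "(x0, w0) \<in> S"
  obtains r B h where "r > 0" "open B" "w0 \<in> B" "ball x0 r \<times> B \<subseteq> S" "\<And>n::nat. h n \<noteq> (0::complex)"
    "\<And>n x w. x \<in> ball x0 r \<Longrightarrow> w \<in> B \<Longrightarrow> (x + h n, w) \<in> S"
    "uniform_limit (ball x0 r \<times> B) (\<lambda>n p. (g (fst p + h n, snd p) - g p) / h n) (D1 g) sequentially"
proof -
  \<comment> \<open>The excess 1 over the value at the centre makes \<open>norm (g p) < M\<close> an
    open condition satisfied there; this is the local bound fed into Cauchy's inequality.\<close>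
  define M where "M = norm (g (x0, w0)) + 1"
  have op: "open (S \<inter> g -` ball 0 M)"
    using cont \<open>open S\<close> by (intro continuous_open_preimage) auto
  obtain A B where "open A" "open B" "x0 \<in> A" "w0 \<in> B" and AB: "A \<times> B \<subseteq> S \<inter> g -` ball 0 M"
    using op by (rule open_prod_elim[where x="(x0,w0)"]) (use \<open>(x0,w0) \<in> S\<close> in \<open>auto simp: M_def\<close>)
  obtain R where "R > 0" and R: "cball x0 R \<subseteq> A"
    using \<open>open A\<close> \<open>x0 \<in> A\<close> open_contains_cball by blast
  \<comment> \<open>Three nested discs: \<open>x\<close> lies in radius \<open>r\<close>,
    \<open>x + h n\<close> in radius \<open>2*r\<close>, and circles of radius \<open>r/2\<close>
    about points of the latter stay in radius \<open>3*r\<close>, which is \<open>R\<close>.\<close>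
  define r where "r = R / 3"
  have "r > 0" using \<open>R > 0\<close> by (simp add: r_def)
  define h where "h n = complex_of_real (r / (real n + 1))" for n
  have h0: "h n \<noteq> 0" for n using \<open>r > 0\<close> unfolding h_def of_real_eq_0_iff by auto
  have hr: "norm (h n) \<le> r" for n
    using \<open>r > 0\<close> unfolding h_def norm_of_real by (auto simp: field_simps)
  have in2: "x + h n \<in> ball x0 (2*r)" if "x \<in> ball x0 r" for x n
  proof -
    have "dist x0 (x + h n) \<le> dist x0 x + norm (h n)"
      using dist_triangle[of x0 "x + h n" x] by (simp add: dist_norm)
    with hr[of n] that show ?thesis by auto
  qed
  have inA: "ball x0 (3*r) \<subseteq> A" using R unfolding r_def by auto
  have hol: "(\<lambda>t. g (t, w)) holomorphic_on ball x0 (3*r)" if "w \<in> B" for w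
    unfolding holomorphic_on_def using that inA AB
    by (auto intro!: field_differentiable_at_within dif)
  have bd: "norm (g (t, w)) \<le> M" if "w \<in> B" "t \<in> ball x0 (3*r)" for t w
    using that inA AB by (force simp: less_imp_le)
  have d2: "norm ((deriv ^^ 2) (\<lambda>t. g (t, w)) y) \<le> fact 2 * M / (r/2)^2" 
    if "w \<in> B" "y \<in> ball x0 (2*r)" for w y
  proof (rule Cauchy_inequality)
    have sub: "cball y (r/2) \<subseteq> ball x0 (3*r)"
    proof
      fix t assume "t \<in> cball y (r/2)"
      then show "t \<in> ball x0 (3*r)" using that \<open>r > 0\<close> dist_triangle[of x0 t y] by auto
    qed
    show "(\<lambda>t. g (t, w)) holomorphic_on ball y (r/2)"
      using hol[OF that(1)] by (rule holomorphic_on_subset) (use sub ball_subset_cball in blast)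
    show "continuous_on (cball y (r/2)) (\<lambda>t. g (t, w))"
      using hol[OF that(1)] sub by (meson continuous_on_subset holomorphic_on_imp_continuous_on)
    show "norm (g (x, w)) \<le> M" if "norm (y - x) = r/2" for x
      using bd[OF \<open>w \<in> B\<close>] sub that by (auto simp: dist_norm subset_eq)
  qed (use \<open>r > 0\<close> in auto)
  define K where "K = fact 2 * M / (r/2)^2"
  have "M \<ge> 1" by (simp add: M_def)
  then have "K > 0" using \<open>r > 0\<close> by (auto simp: K_def)
  have est: "norm ((g (x + h n, w) - g (x, w)) / h n - D1 g (x, w)) \<le> K * norm (h n)"
    if x: "x \<in> ball x0 r" and w: "w \<in> B" for x w n
  proof -
    define f where "f i = (deriv ^^ i) (\<lambda>t. g (t, w))" for i
    have fhol: "f i holomorphic_on ball x0 (3*r)" for i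
      unfolding f_def by (intro holomorphic_higher_deriv hol w) auto
    have "cmod (f 0 (x + h n) - (\<Sum>i\<le>1. f i x * ((x + h n) - x) ^ i / (fact i))) \<le> K * cmod ((x + h n) - x)^(Suc 1) / fact 1"
    proof (rule complex_Taylor)
      show "convex (ball x0 (2*r))" by simp
      show "(f i has_field_derivative f (Suc i) y) (at y within ball x0 (2*r))" if "y \<in> ball x0 (2*r)" for i y
      proof -
        have "(f i has_field_derivative deriv (f i) y) (at y)"
          using fhol[of i] by (rule holomorphic_derivI[of _ "ball x0 (3*r)"]) (use that \<open>r>0\<close> in auto)
        then show ?thesis by (simp add: f_def has_field_derivative_at_within)
      qed
      show "norm (f (Suc 1) y) \<le> K" if "y \<in> ball x0 (2*r)" for y
        using d2[OF w that] by (simp add: f_def K_def numeral_2_eq_2)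
      show "x \<in> ball x0 (2*r)" using x \<open>r > 0\<close> by auto
      show "x + h n \<in> ball x0 (2*r)" using in2 x by auto
    qed
    then have "norm (g (x + h n, w) - g (x, w) - D1 g (x, w) * h n) \<le> K * norm (h n) ^ 2"
      by (simp add: f_def D1_def numeral_2_eq_2 algebra_simps)
    moreover have "norm (g (x + h n, w) - g (x, w) - D1 g (x, w) * h n)
       = norm (((g (x + h n, w) - g (x, w)) / h n - D1 g (x, w)) * h n)"
      using h0[of n] by (simp add: left_diff_distrib diff_divide_distrib)
    ultimately have "norm ((g (x + h n, w) - g (x, w)) / h n - D1 g (x, w)) * norm (h n) \<le> (K * norm (h n)) * norm (h n)"
      by (simp add: norm_mult power2_eq_square mult_ac)
    then show ?thesis using h0[of n] by (simp add: mult_le_cancel_right)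
  qed
  have lim: "(\<lambda>n. K * norm (h n)) \<longlonglongrightarrow> 0"
  proof -
    have "(\<lambda>n. K * r * inverse (real (Suc n))) \<longlonglongrightarrow> K * r * 0"
      by (intro tendsto_intros LIMSEQ_inverse_real_of_nat)
    moreover have "(\<lambda>n. K * norm (h n)) = (\<lambda>n. K * r * inverse (real (Suc n)))"
      using \<open>r > 0\<close> unfolding h_def norm_of_real by (simp add: divide_inverse add.commute mult.assoc)
    ultimately show ?thesis by (simp only: mult_zero_right)
  qed
  show ?thesis
  proof (rule that[OF \<open>r > 0\<close> \<open>open B\<close> \<open>w0 \<in> B\<close> _ h0])
    show "ball x0 r \<times> B \<subseteq> S" using AB inA \<open>r > 0\<close> by (auto simp: subset_eq)
    show "(x + h n, w) \<in> S" if "x \<in> ball x0 r" "w \<in> B" for n x w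
      using in2[OF that(1), of n] that AB inA \<open>r > 0\<close> by (auto simp: subset_eq)
    show "uniform_limit (ball x0 r \<times> B) (\<lambda>n p. (g (fst p + h n, snd p) - g p) / h n) (D1 g) sequentially"
    proof (rule uniform_limitI)
      fix e :: real assume "e > 0"
      from order_tendstoD(2)[OF lim this]
      show "\<forall>\<^sub>F n in sequentially. \<forall>p\<in>ball x0 r \<times> B. dist ((g (fst p + h n, snd p) - g p) / h n) (D1 g p) < e"
        by eventually_elim (auto simp: dist_norm intro: le_less_trans[OF est])
    qed
  qed
qed

lemma hol3_permute:
  assumes "hol3 f S"
  shows "hol3 (\<lambda>(x, y, z). f (y, x, z)) ((\<lambda>(x, y, z). (y, x, z)) -` S)"
    and "hol3 (\<lambda>(x, y, z). f (x, z, y)) ((\<lambda>(x, y, z). (x, z, y)) -` S)"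
proof -
  have o: "open ((\<lambda>(x, y, z). (y, x, z)) -` S)" "open ((\<lambda>(x, y, z). (x, z, y)) -` S)"
    using hol3_open[OF assms] by (auto intro!: open_vimage continuous_intros simp: split_beta')
  show "hol3 (\<lambda>(x, y, z). f (y, x, z)) ((\<lambda>(x, y, z). (y, x, z)) -` S)"
    using hol3_comp[OF assms hol3_snd[OF o(1)] hol3_fst[OF o(1)] hol3_thd[OF o(1)]]
    by (auto simp: split_beta')
  show "hol3 (\<lambda>(x, y, z). f (x, z, y)) ((\<lambda>(x, y, z). (x, z, y)) -` S)"
    using hol3_comp[OF assms hol3_fst[OF o(2)] hol3_thd[OF o(2)] hol3_snd[OF o(2)]]
    by (auto simp: split_beta')
qed

text \<open>Near each point, \<open>D1 g\<close> is a uniform limit of difference quotients, which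
  are continuous because \<open>g\<close> is.\<close>

lemma continuous_on_D1:
  fixes g :: "complex \<times> 'a::metric_space \<Rightarrow> complex"
  assumes "open S" and cont: "continuous_on S g"
    and dif: "\<And>x w. (x, w) \<in> S \<Longrightarrow> (\<lambda>t. g (t, w)) field_differentiable (at x)"
  shows "continuous_on S (D1 g)"
proof (rule continuous_at_imp_continuous_on, safe)
  fix x0 w0 assume p: "(x0, w0) \<in> S"
  obtain r B h where r: "r > 0" "open B" "w0 \<in> B" "ball x0 r \<times> B \<subseteq> S" "\<And>n::nat. h n \<noteq> (0::complex)"
    "\<And>n x w. x \<in> ball x0 r \<Longrightarrow> w \<in> B \<Longrightarrow> (x + h n, w) \<in> S"
    "uniform_limit (ball x0 r \<times> B) (\<lambda>n p. (g (fst p + h n, snd p) - g p) / h n) (D1 g) sequentially"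
    by (rule uniform_difference_quotient[OF assms(1,2) _ p], erule dif) (rule that)
  have "continuous_on (ball x0 r \<times> B) (D1 g)"
    by (rule uniform_limit_theorem[OF _ r(7)])
       (use r in \<open>auto intro!: always_eventually continuous_intros continuous_on_compose2[OF cont]\<close>)
  then show "isCont (D1 g) (x0, w0)"
    using r by (simp add: continuous_on_eq_continuous_at open_Times)
qed

lemma continuous_on_D123:
  assumes "open S" and cont: "continuous_on S f"
    and dif: "\<And>x y z. (x, y, z) \<in> S \<Longrightarrow> (\<lambda>t. f (t, y, z)) field_differentiable (at x)"
       "\<And>x y z. (x, y, z) \<in> S \<Longrightarrow> (\<lambda>t. f (x, t, z)) field_differentiable (at y)"
       "\<And>x y z. (x, y, z) \<in> S \<Longrightarrow> (\<lambda>t. f (x, y, t)) field_differentiable (at z)"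
  shows "continuous_on S (D1 f)" "continuous_on S (D2 f)" "continuous_on S (D3 f)"
proof -
  show "continuous_on S (D1 f)"
    by (rule continuous_on_D1) (use assms in auto)
  let ?s = "\<lambda>(x, y, z). (y, x, z)"
  let ?t = "\<lambda>(x, y, z). (z, y, x)"
  have "continuous_on (?s -` S) (D1 (f \<circ> ?s))"
    by (rule continuous_on_D1) 
       (use assms in \<open>auto intro!: open_vimage continuous_intros continuous_on_compose2[OF cont] simp: split_beta' o_def\<close>)
  then have "continuous_on S (\<lambda>p. D1 (f \<circ> ?s) (?s p))"
    by (rule continuous_on_compose2) (auto intro!: continuous_intros simp: split_beta')
  then show "continuous_on S (D2 f)"
    by (rule continuous_on_eq) (auto simp: D1_def D2_def split_beta' o_def)
  have "continuous_on (?t -` S) (D1 (f \<circ> ?t))"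
    by (rule continuous_on_D1) 
       (use assms in \<open>auto intro!: open_vimage continuous_intros continuous_on_compose2[OF cont] simp: split_beta' o_def\<close>)
  then have "continuous_on S (\<lambda>p. D1 (f \<circ> ?t) (?t p))"
    by (rule continuous_on_compose2) (auto intro!: continuous_intros simp: split_beta')
  then show "continuous_on S (D3 f)"
    by (rule continuous_on_eq) (auto simp: D1_def D3_def split_beta' o_def)
qed

text \<open>Osgood's lemma: the local Cauchy estimates make the partial derivatives continuous.\<close>
lemma hol3_separately:
  assumes "open S" and cont: "continuous_on S f"
    and dif: "\<And>x y z. (x, y, z) \<in> S \<Longrightarrow> (\<lambda>t. f (t, y, z)) field_differentiable (at x)"
       "\<And>x y z. (x, y, z) \<in> S \<Longrightarrow> (\<lambda>t. f (x, t, z)) field_differentiable (at y)"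
       "\<And>x y z. (x, y, z) \<in> S \<Longrightarrow> (\<lambda>t. f (x, y, t)) field_differentiable (at z)"
  shows "hol3 f S"
  unfolding hol3_def
proof (intro conjI ballI assms(1))
  fix p assume "p \<in> S"
  note cD = continuous_on_D123[OF assms]
  obtain x y z where p: "p = (x, y, z)" by (cases p)
  obtain r where r: "r > 0" "cball x r \<times> cball y r \<times> cball z r \<subseteq> S"
    using open_polydisc[OF assms(1)] \<open>p \<in> S\<close> p by blast
  define X where "X = ball x r"
  define Y where "Y = ball y r"
  define Z where "Z = ball z r"
  have XYZ: "open X" "open Y" "open Z" "x \<in> X" "y \<in> Y" "z \<in> Z" "convex Y" "convex Z" 
    and sub: "X \<times> Y \<times> Z \<subseteq> S"
    using r by (auto simp: X_def Y_def Z_def subset_eq)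
  have cD': "continuous_on (X \<times> Y \<times> Z) (D1 f)" "continuous_on (X \<times> Y \<times> Z) (D2 f)" "continuous_on (X \<times> Y \<times> Z) (D3 f)"
    using cD sub by (auto intro: continuous_on_subset)
  have d1: "((\<lambda>t. f (t, b, c)) has_derivative (*) (D1 f (a, b, c))) (at a)" 
   and d2: "((\<lambda>t. f (a, t, c)) has_derivative (*) (D2 f (a, b, c))) (at b)" 
   and d3: "((\<lambda>t. f (a, b, t)) has_derivative (*) (D3 f (a, b, c))) (at c)" 
   if "(a, b, c) \<in> X \<times> Y \<times> Z" for a b c
    using dif[OF subsetD[OF sub that]]
    by (auto simp: D1_def D2_def D3_def field_differentiable_derivI has_field_derivative_def[symmetric])
  \<comment> \<open>The criterion "continuous partials imply differentiable" splits a product into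
    two factors, so it is applied twice: here to the pair of the last two variables with the first
    frozen, and below to the first variable against that pair.\<close>
  have inner: "((\<lambda>(b, c). f (a, b, c)) has_derivative (\<lambda>(tb, tc). D2 f (a, b, c) * tb + D3 f (a, b, c) * tc))
      (at (b, c) within Y \<times> Z)" if "a \<in> X" "b \<in> Y" "c \<in> Z" for a b c
  proof -
    have "((\<lambda>(b, c). f (a, b, c)) has_derivative (\<lambda>(tb, tc). (*) (D2 f (a, b, c)) tb + blinfun_apply (blinfun_mult_right (D3 f (a, b, c))) tc))
      (at (b, c) within Y \<times> Z)"
    proof (rule has_derivative_partialsI)
      show "((\<lambda>x. f (a, x, c)) has_derivative (*) (D2 f (a, b, c))) (at b within Y)"
        using d2[of a b c] that by (auto intro: has_derivative_at_withinI)
      show "((\<lambda>y. f (a, x, y)) has_derivative blinfun_apply (blinfun_mult_right (D3 f (a, x, y)))) (at y within Z)"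
        if "x \<in> Y" "y \<in> Z" for x y
        using d3[of a x y] that \<open>a \<in> X\<close> by (auto intro: has_derivative_at_withinI)
      have "continuous_on (Y \<times> Z) (\<lambda>(x, y). blinfun_mult_right (D3 f (a, x, y)))"
        unfolding split_beta' using \<open>a \<in> X\<close>
        by (intro bounded_linear.continuous_on[OF bounded_linear_blinfun_mult_right] continuous_on_compose2[OF cD'(3)])
           (auto intro!: continuous_intros)
      then show "continuous (at (b, c) within Y \<times> Z) (\<lambda>(x, y). blinfun_mult_right (D3 f (a, x, y)))"
        using that by (simp add: continuous_on_eq_continuous_within split_beta')
    qed (use that XYZ in auto)
    then show ?thesis by simp
  qed
  define L where "L q = (blinfun_mult_right (D2 f q) o\<^sub>L fst_blinfun) + (blinfun_mult_right (D3 f q) o\<^sub>L snd_blinfun)" for q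
  have L: "blinfun_apply (L q) = (\<lambda>(tb, tc). D2 f q * tb + D3 f q * tc)" for q
    by (auto simp: L_def blinfun.add_left)
  have "((\<lambda>(a, bc). f (a, bc)) has_derivative (\<lambda>(ta, tbc). (*) (D1 f (x, y, z)) ta + blinfun_apply (L (x, y, z)) tbc))
    (at (x, (y, z)) within X \<times> (Y \<times> Z))"
  proof (rule has_derivative_partialsI[where fy="\<lambda>a bc. L (a, bc)"])
    show "((\<lambda>xa. f (xa, y, z)) has_derivative (*) (D1 f (x, y, z))) (at x within X)"
      using d1 XYZ by (auto intro: has_derivative_at_withinI)
    show "((\<lambda>y. f (xa, y)) has_derivative blinfun_apply (L (xa, ya))) (at ya within Y \<times> Z)"
      if "xa \<in> X" "ya \<in> Y \<times> Z" for xa ya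
      using inner[of xa "fst ya" "snd ya"] that by (auto simp: L split_beta')
    have "continuous_on (X \<times> Y \<times> Z) (\<lambda>(x, y). L (x, y))"
      unfolding split_beta' L_def
      by (intro continuous_intros bounded_linear.continuous_on[OF bounded_linear_blinfun_mult_right] continuous_on_compose2[OF cD'(3)] continuous_on_compose2[OF cD'(2)]
          bounded_bilinear.continuous_on[OF bounded_bilinear_blinfun_compose])
         (auto intro!: continuous_intros)
    then show "continuous (at (x, y, z) within X \<times> Y \<times> Z) (\<lambda>(x, y). L (x, y))"
      using XYZ by (simp add: continuous_on_eq_continuous_within)
  qed (use XYZ in \<open>auto intro!: convex_Times\<close>)
  moreover have "open (X \<times> Y \<times> Z)" using XYZ by (intro open_Times)
  ultimately have "(f has_derivative (\<lambda>(u, v, w). D1 f p * u + D2 f p * v + D3 f p * w)) (at p)"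
    using XYZ by (simp add: p L at_within_open[of _ "X \<times> Y \<times> Z"] split_beta' add.assoc)
  then show "\<exists>a b c. (f has_derivative (\<lambda>(u, v, w). a * u + b * v + c * w)) (at p)" by blast
qed

lemma hol3_field_differentiable:
  assumes "hol3 f S" "(x, y, z) \<in> S"
  shows "(\<lambda>t. f (t, y, z)) field_differentiable (at x)"
       "(\<lambda>t. f (x, t, z)) field_differentiable (at y)"
       "(\<lambda>t. f (x, y, t)) field_differentiable (at z)"
  using hol3_partials[OF assms] by (auto simp: field_differentiable_def)

lemma hol3_continuous_partials:
  assumes "hol3 f S"
  shows "continuous_on S (D1 f)" "continuous_on S (D2 f)" "continuous_on S (D3 f)"
  using continuous_on_D123[OF hol3_open[OF assms] hol3_continuous[OF assms]]
    hol3_field_differentiable[OF assms] by blast+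

text \<open>On each complex line parallel to an axis this is the one-variable theorem of
  Weierstrass; the limit is also continuous, so Osgood's lemma makes it jointly holomorphic. The map
  \<open>s\<close> stands for any of the three kinds of line.\<close>

lemma hol3_uniform_limit:
  assumes hol: "\<And>n. hol3 (f n) S" and lim: "uniform_limit S f g sequentially"
  shows "hol3 g S"
proof -
  have "open S" using hol[of 0] by (rule hol3_open)
  have slice: "g \<circ> s holomorphic_on s -` S" 
    if s: "continuous_on UNIV s" and d: "\<And>n t. s t \<in> S \<Longrightarrow> (f n \<circ> s) field_differentiable (at t)"
    for s :: "complex \<Rightarrow> complex \<times> complex \<times> complex"
  proof (rule holomorphic_uniform_sequence)
    show o: "open (s -` S)" using s \<open>open S\<close> by (simp add: open_vimage)
    show "f n \<circ> s holomorphic_on s -` S" for n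
      by (auto simp: holomorphic_on_def intro!: field_differentiable_at_within d)
    fix x assume "x \<in> s -` S"
    then obtain d where "d > 0" "cball x d \<subseteq> s -` S" using o open_contains_cball by blast
    moreover have "uniform_limit (cball x d) (\<lambda>n. f n \<circ> s) (g \<circ> s) sequentially"
    proof (rule uniform_limitI)
      fix e :: real assume "e > 0"
      from uniform_limitD[OF lim this]
      show "\<forall>\<^sub>F n in sequentially. \<forall>x\<in>cball x d. dist ((f n \<circ> s) x) ((g \<circ> s) x) < e"
        by eventually_elim (use calculation in auto)
    qed
    ultimately show "\<exists>d>0. cball x d \<subseteq> s -` S \<and> uniform_limit (cball x d) (\<lambda>n. f n \<circ> s) (g \<circ> s) sequentially"
      by blast
  qed
  have slice': "(g \<circ> s) field_differentiable (at t)"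
    if s: "continuous_on UNIV s" and d: "\<And>n t. s t \<in> S \<Longrightarrow> (f n \<circ> s) field_differentiable (at t)" and "s t \<in> S"
    for s :: "complex \<Rightarrow> complex \<times> complex \<times> complex" and t
  proof -
    have "open (s -` S)" using s \<open>open S\<close> by (simp add: open_vimage)
    then show ?thesis
      using slice[OF s d] \<open>s t \<in> S\<close>
      by (intro holomorphic_on_imp_differentiable_at[of _ "s -` S"]) auto
  qed
  show ?thesis
  proof (rule hol3_separately[OF \<open>open S\<close>])
    show "continuous_on S g"
      by (rule uniform_limit_theorem[OF _ lim]) (auto intro!: always_eventually hol3_continuous hol)
    fix x y z assume p: "(x, y, z) \<in> S"
    have [simp]: "continuous_on UNIV (\<lambda>t. (t, y, z))" "continuous_on UNIV (\<lambda>t. (x, t, z))"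
      "continuous_on UNIV (\<lambda>t. (x, y, t))"
      by (intro continuous_intros)+
    show "(\<lambda>t. g (t, y, z)) field_differentiable (at x)"
      using slice'[of "\<lambda>t. (t, y, z)" x] hol3_field_differentiable(1)[OF hol] p
      by (auto simp: o_def)
    show "(\<lambda>t. g (x, t, z)) field_differentiable (at y)"
      using slice'[of "\<lambda>t. (x, t, z)" y] hol3_field_differentiable(2)[OF hol] p
      by (auto simp: o_def)
    show "(\<lambda>t. g (x, y, t)) field_differentiable (at z)"
      using slice'[of "\<lambda>t. (x, y, t)" z] hol3_field_differentiable(3)[OF hol] p
      by (auto simp: o_def)
  qed
qed

section \<open>Holomorphy of the partial derivatives\<close>

lemma hol3_locally:
  assumes "open S" "\<And>p. p \<in> S \<Longrightarrow> \<exists>T. p \<in> T \<and> hol3 f T"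
  shows "hol3 f S"
  using assms unfolding hol3_def by blast

text \<open>The difference quotients combine \<open>f\<close> with a translate of itself and are
  thus holomorphic, and they converge locally uniformly to \<open>D1 f\<close>.\<close>

lemma hol3_D1:
  assumes "hol3 f S"
  shows "hol3 (D1 f) S"
proof (rule hol3_locally)
  fix p assume "p \<in> S"
  obtain x0 w0 where p: "p = (x0, w0)" by (cases p)
  obtain r B h where r: "r > 0" "open B" "w0 \<in> B" "ball x0 r \<times> B \<subseteq> S" "\<And>n::nat. h n \<noteq> (0::complex)"
    "\<And>n x w. x \<in> ball x0 r \<Longrightarrow> w \<in> B \<Longrightarrow> (x + h n, w) \<in> S"
    and lim: "uniform_limit (ball x0 r \<times> B) (\<lambda>n p. (f (fst p + h n, snd p) - f p) / h n) (D1 f) sequentially"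
  proof (rule uniform_difference_quotient)
    show "open S" "continuous_on S f" "(x0, w0) \<in> S"
      using hol3_open[OF assms] hol3_continuous[OF assms] \<open>p \<in> S\<close> p by auto
    show "(\<lambda>t. f (t, w)) field_differentiable at x" if "(x, w) \<in> S" for x w
      using hol3_field_differentiable(1)[OF assms, of x "fst w" "snd w"] that by simp
  qed (rule that)
  have o: "open (ball x0 r \<times> B)" using r by (intro open_Times) auto
  have "hol3 (\<lambda>p. (f (fst p + h n, fst (snd p), snd (snd p)) - f p) / h n) (ball x0 r \<times> B)" for n
    by (intro hol3_intros hol3_comp[OF assms] o hol3_subset[OF assms] r) (use r in auto)
  then have "hol3 (D1 f) (ball x0 r \<times> B)"
    using hol3_uniform_limit[OF _ lim] by simp
  then show "\<exists>T. p \<in> T \<and> hol3 (D1 f) T" using r p by (intro exI[of _ "ball x0 r \<times> B"]) auto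
qed (rule hol3_open[OF assms])

text \<open>Conjugating with the swap of the first two coordinates turns \<open>D1\<close> into
  \<open>D2\<close>; the swap of the last two then turns \<open>D2\<close> into
  \<open>D3\<close>.\<close>

lemma hol3_D2:
  assumes "hol3 f S"
  shows "hol3 (D2 f) S"
proof -
  from hol3_permute(1)[OF hol3_D1[OF hol3_permute(1)[OF assms]]]
  show ?thesis by (simp add: vimage_def D1_def[abs_def] D2_def[abs_def] split_beta')
qed

lemma hol3_D3:
  assumes "hol3 f S"
  shows "hol3 (D3 f) S"
proof -
  from hol3_permute(2)[OF hol3_D2[OF hol3_permute(2)[OF assms]]]
  show ?thesis by (simp add: vimage_def D3_def[abs_def] D2_def[abs_def] split_beta')
qed

text \<open>The inverse function theorem is applied to (x, y, z) -> (x, y, h), which keeps the first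
  two coordinates, so only the last component \<open>k\<close> of the inverse carries information.
  Both inversion identities are recorded because the map later serves as a change of
  coordinates.\<close>

lemma hol3_implicit_function:
  assumes h: "hol3 h S" and p: "p \<in> S" and nz: "D3 h p \<noteq> 0"
  obtains N V k where "open N" "p \<in> N" "N \<subseteq> S" "hol3 k V" 
    "(\<lambda>(x, y, z). (x, y, h (x, y, z))) ` N = V"
    "\<And>x y z. (x, y, z) \<in> N \<Longrightarrow> k (x, y, h (x, y, z)) = z"
    "\<And>x y w. (x, y, w) \<in> V \<Longrightarrow> (x, y, k (x, y, w)) \<in> N \<and> h (x, y, k (x, y, w)) = w"
    "\<And>q. q \<in> N \<Longrightarrow> D3 h q \<noteq> 0"
proof -
  \<comment> \<open>Shrinking to \<open>D3 h\<close> nonzero makes the derivative of the coordinate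
    map invertible at every point, so the inverse has a computable derivative on all of
    \<open>V\<close> and not merely at the image of \<open>p\<close>.\<close>
  define U where "U = S \<inter> D3 h -` (- {0})"
  have "open U" unfolding U_def
    using hol3_continuous_partials(3)[OF h] hol3_open[OF h] by (intro continuous_open_preimage) auto
  have pU: "p \<in> U" using p nz by (simp add: U_def)
  define F where "F = (\<lambda>(x, y, z). (x, y, h (x, y, z)))"
  define F' where "F' q = Blinfun (\<lambda>(u, v, w). (u, v, D1 h q * u + D2 h q * v + D3 h q * w))" for q
  have bl: "bounded_linear (\<lambda>(u, v, w). (u, v, a * u + b * v + c * w))" for a b c :: complex
    unfolding split_beta' by (intro bounded_linear_intros bounded_linear_Pair bounded_linear_mult_right[THEN bounded_linear_compose] bounded_linear_fst bounded_linear_snd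
      bounded_linear_compose[OF bounded_linear_fst bounded_linear_snd] bounded_linear_compose[OF bounded_linear_snd bounded_linear_snd])
  have F': "blinfun_apply (F' q) = (\<lambda>(u, v, w). (u, v, D1 h q * u + D2 h q * v + D3 h q * w))" for q
    unfolding F'_def using bl by (rule bounded_linear_Blinfun_apply)
  have derF: "(F has_derivative blinfun_apply (F' q)) (at q)" if "q \<in> U" for q
  proof -
    have "(h has_derivative (\<lambda>(u, v, w). D1 h q * u + D2 h q * v + D3 h q * w)) (at q)"
      using hol3_has_derivative[OF h] that by (auto simp: U_def)
    then have "((\<lambda>p. (fst p, fst (snd p), h p)) has_derivative 
       (\<lambda>p. (fst p, fst (snd p), (\<lambda>(u, v, w). D1 h q * u + D2 h q * v + D3 h q * w) p))) (at q)"
      by (auto intro!: derivative_eq_intros)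
    then show ?thesis by (simp add: F' F_def split_beta')
  qed
  have contF: "continuous_on U F'"
    unfolding U_def
    by (intro continuous_on_blinfun_componentwise)
       (auto simp: F' split_beta' intro!: continuous_intros hol3_continuous_partials[OF h, THEN continuous_on_subset])
  \<comment> \<open>The inverse of the triangular Jacobian. The inverse function theorem is real;
    this explicit form shows that the derivative of the inverse map is complex linear.\<close>
  define G where "G q = (\<lambda>(u, v, w). (u, v, (w - D1 h q * u - D2 h q * v) / D3 h q))" for q
  have "bounded_linear (G p)"
  proof -
    have "G p = (\<lambda>(u, v, w). (u, v, (- D1 h p / D3 h p) * u + (- D2 h p / D3 h p) * v + (1 / D3 h p) * w))"
      using nz by (auto simp: G_def field_simps)
    then show ?thesis using bl by (simp only:)
  qed
  then have inv: "Blinfun (G p) o\<^sub>L F' p = id_blinfun"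
    by (intro blinfun_eqI) (use nz in \<open>auto simp: F' bounded_linear_Blinfun_apply G_def\<close>)
  obtain U' V g g' where g: "open U'" "U' \<subseteq> U" "p \<in> U'" "open V" "F p \<in> V" "homeomorphism U' V F g"
    "\<And>y. y \<in> V \<Longrightarrow> (g has_derivative (g' y)) (at y)"
    "\<And>y. y \<in> V \<Longrightarrow> g' y = inv (blinfun_apply (F'(g y)))"
    using inverse_function_theorem[OF \<open>open U\<close> derF contF pU inv] by metis
  have gV: "g y \<in> U'" "F (g y) = y" if "y \<in> V" for y
    using homeomorphism_image2[OF g(6)] homeomorphism_apply2[OF g(6)] that by blast+
  have gU: "g (F q) = q" "F q \<in> V" if "q \<in> U'" for q
    using homeomorphism_image1[OF g(6)] homeomorphism_apply1[OF g(6)] that by blast+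
  have g'G: "g' y = G (g y)" if "y \<in> V" for y
  proof -
    have "D3 h (g y) \<noteq> 0" using gV[OF that] g(2) by (auto simp: U_def)
    then have "inv (blinfun_apply (F' (g y))) = G (g y)"
      by (intro inv_equality) (auto simp: F' G_def)
    then show ?thesis using g(8)[OF that] by simp
  qed
  show ?thesis
  proof (rule that[of U' "\<lambda>q. snd (snd (g q))" V])
    show "U' \<subseteq> S" "\<And>q. q \<in> U' \<Longrightarrow> D3 h q \<noteq> 0" using g(2) by (auto simp: U_def)
    show "hol3 (\<lambda>q. snd (snd (g q))) V"
      unfolding hol3_def
    proof (intro conjI ballI)
      fix y assume y: "y \<in> V"
      have nz: "D3 h (g y) \<noteq> 0" using gV[OF y] g(2) by (auto simp: U_def)
      have "((\<lambda>q. snd (snd (g q))) has_derivative (\<lambda>t. snd (snd (g' y t)))) (at y)"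
        by (intro has_derivative_snd g(7) y)
      moreover have "(\<lambda>t. snd (snd (g' y t))) = (\<lambda>(u, v, w). (- D1 h (g y) / D3 h (g y)) * u + (- D2 h (g y) / D3 h (g y)) * v + (1 / D3 h (g y)) * w)"
        using nz by (auto simp: g'G[OF y] G_def field_simps)
      ultimately show "\<exists>a b c. ((\<lambda>q. snd (snd (g q))) has_derivative (\<lambda>(u, v, w). a * u + b * v + c * w)) (at y)"
        by metis
    qed (rule g)
    show "(\<lambda>(x, y, z). (x, y, h (x, y, z))) ` U' = V"
      using homeomorphism_image1[OF g(6)] by (simp add: F_def)
    show "snd (snd (g (x, y, h (x, y, z)))) = z" if "(x, y, z) \<in> U'" for x y z
      using gU(1)[OF that] by (simp add: F_def)
    show "(x, y, snd (snd (g (x, y, w)))) \<in> U' \<and> h (x, y, snd (snd (g (x, y, w)))) = w" if "(x, y, w) \<in> V" for x y w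
      using gV[OF that] by (cases "g (x, y, w)") (auto simp: F_def)
  qed (use g in auto)
qed

section \<open>Holomorphic differential equations\<close>

abbreviation polydisc :: "real \<Rightarrow> (complex \<times> complex \<times> complex) set" where
  "polydisc r \<equiv> ball 0 r \<times> ball 0 r \<times> ball 0 r"

lemma open_polydisc0: "open (polydisc r)"
  by (intro open_Times) auto

text \<open>The primitive of \<open>G\<close> in the middle variable y that vanishes at y = 0.
  Substituting \<theta> y for the integration variable gives a fixed interval, so all dependence on
  the three variables sits in the integrand and in the factor y.\<close>

definition ray_integral :: "(complex \<times> complex \<times> complex \<Rightarrow> complex) \<Rightarrow> complex \<times> complex \<times> complex \<Rightarrow> complex" where
  "ray_integral G p = fst (snd p) *
     integral {0..1} (\<lambda>\<theta>. G (fst p, complex_of_real \<theta> * fst (snd p), snd (snd p)))"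

lemma scaled_in_ball: "\<theta> \<in> {0..1} \<Longrightarrow> t \<in> ball 0 r \<Longrightarrow> complex_of_real \<theta> * t \<in> ball 0 r"
  by (auto simp: norm_mult intro: le_less_trans[OF mult_left_le_one_le])

lemma ray_integral_continuous_param:
  assumes "continuous_on (polydisc r) G" 
  shows "continuous_on (polydisc r \<times> {0..1}) (\<lambda>(p, \<theta>). G (fst p, complex_of_real \<theta> * fst (snd p), snd (snd p)))"
  unfolding split_beta'
  by (rule continuous_on_compose2[OF assms])
     (auto intro!: continuous_intros scaled_in_ball[simplified])

lemma ray_integral_continuous_path:
  assumes "continuous_on (polydisc r) G" "(s, t, z) \<in> polydisc r"
  shows "continuous_on {0..1} (\<lambda>\<theta>. G (s, complex_of_real \<theta> * t, z))"
  by (rule continuous_on_compose2[OF assms(1)])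
     (use assms(2) in \<open>auto intro!: continuous_intros scaled_in_ball[simplified]\<close>)

text \<open>Serves twice in the Picard iteration: with \<open>G'\<close> zero it keeps the iterates
  bounded, and with two iterates inserted it gives the contraction estimate.\<close>

lemma ray_integral_diff_bound:
  assumes "continuous_on (polydisc r) G" "continuous_on (polydisc r) G'"
    and "\<And>q. q \<in> polydisc r \<Longrightarrow> norm (G q - G' q) \<le> K" "p \<in> polydisc r"
  shows "norm (ray_integral G p - ray_integral G' p) \<le> K * norm (fst (snd p))"
proof -
  obtain s t z where p: "p = (s, t, z)" by (cases p)
  have c: "continuous_on {0..1} (\<lambda>\<theta>. G (s, complex_of_real \<theta> * t, z))"
     "continuous_on {0..1} (\<lambda>\<theta>. G' (s, complex_of_real \<theta> * t, z))"
    using ray_integral_continuous_path[OF assms(1)] ray_integral_continuous_path[OF assms(2)] assms(4) p by auto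
  define I where "I = integral {0..1} (\<lambda>\<theta>. G (s, complex_of_real \<theta> * t, z) - G' (s, complex_of_real \<theta> * t, z))"
  have "ray_integral G p - ray_integral G' p = t * I"
    unfolding I_def using c
    by (simp add: ray_integral_def p right_diff_distrib Henstock_Kurzweil_Integration.integral_diff integrable_continuous_real)
  moreover have "norm I \<le> K * (1 - 0)"
    unfolding I_def using c assms(4) p
    by (intro integral_bound ballI assms(3)) (auto intro!: continuous_intros scaled_in_ball[simplified])
  ultimately show ?thesis
    using mult_right_mono[of "norm I" "K * (1 - 0)" "norm t"] by (simp add: norm_mult p mult.commute)
qed

text \<open>A disc is convex, so the slice has a primitive \<open>H\<close>; the fundamental theorem
  of calculus along the ray identifies the integral with \<open>H t - H 0\<close>.\<close>

lemma ray_integral_has_field_derivative: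
  assumes G: "hol3 G (polydisc r)" and p: "(s, t, z) \<in> polydisc r"
  shows "((\<lambda>t. ray_integral G (s, t, z)) has_field_derivative G (s, t, z)) (at t)"
proof -
  have "(\<lambda>t. G (s, t, z)) holomorphic_on ball 0 r"
    using p by (auto simp: holomorphic_on_def
        intro!: field_differentiable_at_within[OF hol3_field_differentiable(2)[OF G]])
  then obtain H where H: "\<And>t. t \<in> ball 0 r \<Longrightarrow> (H has_field_derivative G (s, t, z)) (at t within ball 0 r)"
    using holomorphic_convex_primitive'[of "ball 0 r" "\<lambda>t. G (s, t, z)"] by auto
  then have H': "(H has_field_derivative G (s, t, z)) (at t)" if "t \<in> ball 0 r" for t
    using that at_within_open[of t "ball 0 r"] by force
  have eq: "ray_integral G (s, t, z) = H t - H 0" if t: "t \<in> ball 0 r" for t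
  proof -
    have "((\<lambda>\<theta>. t * G (s, complex_of_real \<theta> * t, z)) has_integral (H (complex_of_real 1 * t) - H (complex_of_real 0 * t))) {0..1}"
    proof (rule fundamental_theorem_of_calculus)
      fix \<theta> :: real assume "\<theta> \<in> {0..1}"
      then have "(H has_field_derivative G (s, complex_of_real \<theta> * t, z)) (at (complex_of_real \<theta> * t))"
        by (intro H' scaled_in_ball t)
      moreover have "((\<lambda>\<theta>. complex_of_real \<theta> * t) has_vector_derivative t) (at \<theta> within {0..1})"
        by (auto intro!: derivative_eq_intros)
      ultimately have "(H \<circ> (\<lambda>\<theta>. complex_of_real \<theta> * t) has_vector_derivative t * G (s, complex_of_real \<theta> * t, z)) (at \<theta> within {0..1})"
        by (rule field_vector_diff_chain_within[rotated, OF has_field_derivative_at_within])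
      then show "((\<lambda>\<theta>. H (complex_of_real \<theta> * t)) has_vector_derivative t * G (s, complex_of_real \<theta> * t, z)) (at \<theta> within {0..1})"
        by (simp add: o_def)
    qed simp
    from integral_unique[OF this] show ?thesis by (simp add: ray_integral_def)
  qed
  have "((\<lambda>t. H t - H 0) has_field_derivative G (s, t, z)) (at t)"
    using H'[of t] p by (auto intro!: derivative_eq_intros)
  then show ?thesis
    by (rule has_field_derivative_transform_within_open[of _ _ _ "ball 0 r"]) (use p eq in auto)
qed

text \<open>By Osgood's lemma one variable at a time is enough: in the middle one the function is a
  primitive, in the other two one differentiates under the integral sign.\<close>

lemma hol3_ray_integral:
  assumes G: "hol3 G (polydisc r)"
  shows "hol3 (ray_integral G) (polydisc r)"
proof (rule hol3_separately[OF open_polydisc0])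
  note cG = hol3_continuous[OF G] and cD = hol3_continuous_partials[OF G]
  have "continuous_on (polydisc r) (\<lambda>p. integral (cbox 0 1) (\<lambda>\<theta>. G (fst p, complex_of_real \<theta> * fst (snd p), snd (snd p))))"
    using ray_integral_continuous_param[OF cG] by (intro integral_continuous_on_param) simp
  then show "continuous_on (polydisc r) (ray_integral G)"
    unfolding ray_integral_def by (intro continuous_intros) (simp add: case_prod_unfold)
  fix x y z assume p: "(x, y, z) \<in> polydisc r"
  show "(\<lambda>t. ray_integral G (x, t, z)) field_differentiable at y"
    using ray_integral_has_field_derivative[OF G p] by (auto simp: field_differentiable_def)
  have "(\<lambda>s. integral (cbox 0 1) (\<lambda>\<theta>. G (s, complex_of_real \<theta> * y, z))) holomorphic_on ball 0 r"
  proof (rule leibniz_rule_holomorphic)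
    show "((\<lambda>s. G (s, complex_of_real \<theta> * y, z)) has_field_derivative D1 G (s, complex_of_real \<theta> * y, z)) (at s within ball 0 r)"
      if "s \<in> ball 0 r" "\<theta> \<in> cbox 0 1" for s \<theta>
      using that p scaled_in_ball[of \<theta> y r]
      by (auto intro!: has_field_derivative_at_within[OF hol3_partials(1)[OF G]])
    show "(\<lambda>\<theta>. G (s, complex_of_real \<theta> * y, z)) integrable_on cbox 0 1" if "s \<in> ball 0 r" for s
      using ray_integral_continuous_path[OF cG, of s y z] that p by (intro integrable_continuous) auto
    show "continuous_on (ball 0 r \<times> cbox 0 1) (\<lambda>(s, \<theta>). D1 G (s, complex_of_real \<theta> * y, z))"
      unfolding split_beta' using p
      by (intro continuous_on_compose2[OF cD(1)]) (auto intro!: continuous_intros scaled_in_ball[simplified])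
  qed simp
  then have "(\<lambda>s. y * integral (cbox 0 1) (\<lambda>\<theta>. G (s, complex_of_real \<theta> * y, z))) holomorphic_on ball 0 r"
    by (intro holomorphic_intros)
  then show "(\<lambda>s. ray_integral G (s, y, z)) field_differentiable at x"
    using p by (auto simp: ray_integral_def intro!: holomorphic_on_imp_differentiable_at[of _ "ball 0 r"])
  have "(\<lambda>s. integral (cbox 0 1) (\<lambda>\<theta>. G (x, complex_of_real \<theta> * y, s))) holomorphic_on ball 0 r"
  proof (rule leibniz_rule_holomorphic)
    show "((\<lambda>s. G (x, complex_of_real \<theta> * y, s)) has_field_derivative D3 G (x, complex_of_real \<theta> * y, s)) (at s within ball 0 r)"
      if "s \<in> ball 0 r" "\<theta> \<in> cbox 0 1" for s \<theta>
      using that p scaled_in_ball[of \<theta> y r]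
      by (auto intro!: has_field_derivative_at_within[OF hol3_partials(3)[OF G]])
    show "(\<lambda>\<theta>. G (x, complex_of_real \<theta> * y, s)) integrable_on cbox 0 1" if "s \<in> ball 0 r" for s
      using ray_integral_continuous_path[OF cG, of x y s] that p by (intro integrable_continuous) auto
    show "continuous_on (ball 0 r \<times> cbox 0 1) (\<lambda>(s, \<theta>). D3 G (x, complex_of_real \<theta> * y, s))"
      unfolding split_beta' using p
      by (intro continuous_on_compose2[OF cD(3)]) (auto intro!: continuous_intros scaled_in_ball[simplified])
  qed simp
  then have "(\<lambda>s. y * integral (cbox 0 1) (\<lambda>\<theta>. G (x, complex_of_real \<theta> * y, s))) holomorphic_on ball 0 r"
    by (intro holomorphic_intros)
  then show "(\<lambda>s. ray_integral G (x, y, s)) field_differentiable at z"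
    using p by (auto simp: ray_integral_def intro!: holomorphic_on_imp_differentiable_at[of _ "ball 0 r"])
qed

text \<open>Picard iteration in y, with x a parameter and z the initial value. All iterates are
  jointly holomorphic and converge uniformly, so holomorphic dependence on the parameter and the
  initial value needs no separate argument.\<close>

lemma hol3_ode:
  assumes b: "hol3 b S" and "(0, 0, 0) \<in> S"
  obtains r Z where "r > 0" "hol3 Z (polydisc r)"
    "\<And>x y z. (x, y, z) \<in> polydisc r \<Longrightarrow> (x, y, Z (x, y, z)) \<in> S"
    "\<And>x z. (x, 0, z) \<in> polydisc r \<Longrightarrow> Z (x, 0, z) = z"
    "\<And>x y z. (x, y, z) \<in> polydisc r \<Longrightarrow> D2 Z (x, y, z) = b (x, y, Z (x, y, z))"
proof -
  obtain R where "R > 0" and R: "cball 0 R \<times> cball 0 R \<times> cball 0 R \<subseteq> S"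
    using open_polydisc[OF hol3_open[OF b] assms(2)] by metis
  let ?C = "cball (0::complex) R \<times> cball (0::complex) R \<times> cball (0::complex) R"
  have cC: "compact ?C" by (intro compact_Times compact_cball)
  have "compact (b ` ?C)" "compact (D3 b ` ?C)"
    using hol3_continuous[OF b] hol3_continuous_partials(3)[OF b] R 
    by (auto intro!: compact_continuous_image cC intro: continuous_on_subset)
  then have bd: "bounded (b ` ?C)" "bounded (D3 b ` ?C)" by (auto intro: compact_imp_bounded)
  obtain M where "M > 0" and M: "\<And>q. q \<in> ?C \<Longrightarrow> norm (b q) \<le> M"
    using bd(1) unfolding bounded_pos by blast
  obtain L where "L > 0" and L: "\<And>q. q \<in> ?C \<Longrightarrow> norm (D3 b q) \<le> L"
    using bd(2) unfolding bounded_pos by blast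
  have lip: "norm (b (x, y, z) - b (x, y, z')) \<le> L * norm (z - z')"
    if "(x, y, z) \<in> ?C" "(x, y, z') \<in> ?C" for x y z z'
  proof (rule field_differentiable_bound[of "cball 0 R" _ "\<lambda>z. D3 b (x, y, z)"])
    show "((\<lambda>z. b (x, y, z)) has_field_derivative D3 b (x, y, w)) (at w within cball 0 R)" if "w \<in> cball 0 R" for w
      using that R \<open>(x, y, z) \<in> ?C\<close> 
      by (auto intro!: has_field_derivative_at_within[OF hol3_partials(3)[OF b]])
  qed (use that L in auto)
  \<comment> \<open>The three bounds have separate tasks: \<open>R / 2\<close> limits the initial
    value, \<open>R / (2 * M)\<close> limits the integral term to \<open>R / 2\<close> so that
    iterates stay in the disc of radius \<open>R\<close>, and \<open>1 / (2 * L)\<close> makes the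
    contraction factor one half.\<close>
  define r where "r = min (R / 2) (min (R / (2 * M)) (1 / (2 * L)))"
  have "r > 0" using \<open>R > 0\<close> \<open>M > 0\<close> \<open>L > 0\<close> by (simp add: r_def)
  have "r \<le> R / 2" "r \<le> R / (2 * M)" "r \<le> 1 / (2 * L)" by (auto simp: r_def)
  then have r: "r \<le> R / 2" "M * r \<le> R / 2" "L * r \<le> 1 / 2"
    using \<open>M > 0\<close> \<open>L > 0\<close> by (auto simp: field_simps)
  let ?P = "polydisc r"
  define J where "J = (\<lambda>(Z :: complex \<times> complex \<times> complex \<Rightarrow> complex) q. b (fst q, fst (snd q), Z q))"
  define Z where "Z = rec_nat (\<lambda>p. snd (snd p)) (\<lambda>n Z p. snd (snd p) + ray_integral (J Z) p)"
  have Z0: "Z 0 = (\<lambda>p. snd (snd p))" and ZS: "Z (Suc n) = (\<lambda>p. snd (snd p) + ray_integral (J (Z n)) p)" for n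
    by (simp_all add: Z_def)
  have inC: "(fst q, fst (snd q), w) \<in> ?C" if "q \<in> ?P" "norm w \<le> R" for q w
    using that r \<open>R > 0\<close> by auto
  have JC: "hol3 (J W) ?P" if "hol3 W ?P" "\<And>p. p \<in> ?P \<Longrightarrow> norm (W p) \<le> R" for W
    unfolding J_def
    by (intro hol3_comp[OF b] hol3_fst hol3_snd open_polydisc0 that(1) subsetD[OF R] inC that(2))
  have Zn: "hol3 (Z n) ?P \<and> (\<forall>p\<in>?P. norm (Z n p) \<le> R)" for n
  proof (induction n)
    case 0
    then show ?case using r \<open>R > 0\<close> by (auto simp: Z0 intro!: hol3_thd open_polydisc0)
  next
    case (Suc n)
    have J: "hol3 (J (Z n)) ?P" using Suc JC by blast
    have "norm (Z (Suc n) p) \<le> R" if "p \<in> ?P" for p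
    proof -
      have "norm (ray_integral (J (Z n)) p - ray_integral (\<lambda>q. 0) p) \<le> M * norm (fst (snd p))"
      proof (rule ray_integral_diff_bound)
        show "norm (J (Z n) q - 0) \<le> M" if "q \<in> ?P" for q
          using M[OF inC[OF that]] Suc that by (auto simp: J_def)
      qed (use J that in \<open>auto intro: hol3_continuous\<close>)
      also have "\<dots> \<le> M * r" using that \<open>M > 0\<close> by auto
      finally have "norm (ray_integral (J (Z n)) p) \<le> R / 2" using r by (simp add: ray_integral_def)
      moreover have "norm (snd (snd p)) \<le> R / 2" using that r by auto
      ultimately show ?thesis unfolding ZS using norm_triangle_ineq[of "snd (snd p)" "ray_integral (J (Z n)) p"] by linarith
    qed
    then show ?case using J by (auto simp: ZS intro!: hol3_add hol3_ray_integral hol3_thd open_polydisc0)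
  qed
  have contr: "norm (ray_integral (J V) p - ray_integral (J W) p) \<le> K / 2"
    if V: "hol3 V ?P" "\<And>p. p \<in> ?P \<Longrightarrow> norm (V p) \<le> R" and W: "hol3 W ?P" "\<And>p. p \<in> ?P \<Longrightarrow> norm (W p) \<le> R"
     and K: "\<And>q. q \<in> ?P \<Longrightarrow> norm (V q - W q) \<le> K" and p: "p \<in> ?P" for V W K p
  proof -
    have "K \<ge> 0" using K[OF p] norm_ge_zero order_trans by blast
    have "norm (ray_integral (J V) p - ray_integral (J W) p) \<le> (L * K) * norm (fst (snd p))"
    proof (rule ray_integral_diff_bound)
      show "norm (J V q - J W q) \<le> L * K" if "q \<in> ?P" for q
      proof -
        have "norm (J V q - J W q) \<le> L * norm (V q - W q)"
          unfolding J_def by (intro lip inC that V(2) W(2))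
        also have "\<dots> \<le> L * K" using K[OF that] \<open>L > 0\<close> by (intro mult_left_mono) auto
        finally show ?thesis .
      qed
    qed (use V W p JC in \<open>auto intro!: hol3_continuous\<close>)
    also have "\<dots> \<le> (L * K) * r" using p \<open>L > 0\<close> \<open>K \<ge> 0\<close> by (intro mult_left_mono) auto
    also have "\<dots> = (L * r) * K" by simp
    also have "\<dots> \<le> (1/2) * K" using r \<open>K \<ge> 0\<close> by (intro mult_right_mono)
    finally show ?thesis by simp
  qed
  \<comment> \<open>The start value \<open>2 * R\<close> is the crude distance of two functions
    bounded by \<open>R\<close>; each further iteration halves it.\<close>
  have step: "\<forall>p\<in>?P. norm (Z (Suc n) p - Z n p) \<le> 2 * R * (1/2)^n" for n
  proof (induction n)
    case 0
    have "norm (Z (Suc 0) p - Z 0 p) \<le> 2 * R" if "p \<in> ?P" for p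
    proof -
      have "norm (Z (Suc 0) p) \<le> R" "norm (Z 0 p) \<le> R" using Zn that by blast+
      then show ?thesis using norm_triangle_ineq4[of "Z (Suc 0) p" "Z 0 p"] by linarith
    qed
    then show ?case by simp
  next
    case (Suc n)
    have "norm (ray_integral (J (Z (Suc n))) p - ray_integral (J (Z n)) p) \<le> (2 * R * (1/2)^n) / 2" if "p \<in> ?P" for p
      using Zn Suc that by (intro contr) auto
    then show ?case unfolding ZS[of "Suc n"] ZS[of n] by (simp add: ZS)
  qed
  \<comment> \<open>Writing the limit as a telescoping series makes uniform convergence a case of
    the Weierstrass M-test with a geometric majorant.\<close>
  define Zl where "Zl p = Z 0 p + (\<Sum>i. Z (Suc i) p - Z i p)" for p
  have "uniform_limit ?P (\<lambda>n x. \<Sum>i<n. Z (Suc i) x - Z i x) (\<lambda>x. \<Sum>i. Z (Suc i) x - Z i x) sequentially"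
    by (rule Weierstrass_m_test[where M="\<lambda>n. 2 * R * (1/2)^n"])
       (use step in \<open>auto intro!: summable_mult summable_geometric\<close>)
  moreover have "(\<Sum>i<n. Z (Suc i) x - Z i x) = Z n x - Z 0 x" for n x
    by (rule sum_lessThan_telescope)
  ultimately have "uniform_limit ?P (\<lambda>n x. Z n x - Z 0 x) (\<lambda>x. \<Sum>i. Z (Suc i) x - Z i x) sequentially"
    by (simp only:)
  then have lim: "uniform_limit ?P Z Zl sequentially"
    by (simp add: uniform_limit_iff dist_norm Zl_def algebra_simps)
  have holZ: "hol3 Zl ?P"
    using hol3_uniform_limit[OF _ lim] Zn by blast
  have ZlR: "norm (Zl p) \<le> R" if "p \<in> ?P" for p
  proof -
    have "(\<lambda>n. Z n p) \<longlonglongrightarrow> Zl p" using lim that by (rule tendsto_uniform_limitI)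
    then show ?thesis
      by (rule Lim_bounded[OF tendsto_norm, of _ _ 0]) (use Zn that in auto)
  qed
  \<comment> \<open>The integral equation passes to the limit through \<open>contr\<close>, now
    comparing an iterate with \<open>Zl\<close> and taking \<open>K\<close> to be the prescribed
    error.\<close>
  have eq: "Zl p = snd (snd p) + ray_integral (J Zl) p" if p: "p \<in> ?P" for p
  proof (rule LIMSEQ_unique)
    show "(\<lambda>n. Z (Suc n) p) \<longlonglongrightarrow> Zl p"
      using tendsto_uniform_limitI[OF lim p] by (rule LIMSEQ_Suc)
    show "(\<lambda>n. Z (Suc n) p) \<longlonglongrightarrow> snd (snd p) + ray_integral (J Zl) p"
    proof (rule tendstoI)
      fix e :: real assume "e > 0"
      from uniform_limitD[OF lim this]
      show "\<forall>\<^sub>F n in sequentially. dist (Z (Suc n) p) (snd (snd p) + ray_integral (J Zl) p) < e"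
      proof eventually_elim
        fix n assume *: "\<forall>x\<in>?P. dist (Z n x) (Zl x) < e"
        have "norm (ray_integral (J (Z n)) p - ray_integral (J Zl) p) \<le> e / 2"
          using * Zn holZ ZlR p by (intro contr) (auto simp: dist_norm less_imp_le)
        then show "dist (Z (Suc n) p) (snd (snd p) + ray_integral (J Zl) p) < e"
          using \<open>e > 0\<close> by (simp add: ZS dist_norm)
      qed
    qed
  qed
  show ?thesis
  proof (rule that[of r Zl])
    fix x y z assume p: "(x, y, z) \<in> ?P"
    show "(x, y, Zl (x, y, z)) \<in> S"
      using inC[OF p ZlR[OF p]] R by auto
    have "((\<lambda>t. z + ray_integral (J Zl) (x, t, z)) has_field_derivative J Zl (x, y, z)) (at y)"
      using ray_integral_has_field_derivative[OF JC[OF holZ ZlR] p] by (auto intro!: derivative_eq_intros)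
    then have "((\<lambda>t. Zl (x, t, z)) has_field_derivative J Zl (x, y, z)) (at y)"
      by (rule has_field_derivative_transform_within_open[of _ _ _ "ball 0 r"]) (use p eq in auto)
    then show "D2 Zl (x, y, z) = b (x, y, Zl (x, y, z))"
      by (simp add: D2_def J_def DERIV_imp_deriv)
  next
    fix x z assume "(x, 0, z) \<in> ?P"
    then show "Zl (x, 0, z) = z" using eq[of "(x, 0, z)"] by (simp add: ray_integral_def)
  qed (use \<open>r > 0\<close> holZ in auto)
qed

section \<open>Legendrian curves\<close>

text \<open>Straight lines $x = at$, $u = bt$ miss the prescribed height \<open>c\<close>. Adding the small, fast
  oscillations $\varepsilon(e^{i\omega t}-1)$ and $\varepsilon\mu(e^{-i\omega t}-1)$ with $\varepsilon^2\omega = 1$ and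
  $\omega \in 2\pi\mathbb{N}$ keeps the end points, while their product adds a drift of
  velocity $i\mu$ to the height. The choice of $\mu$ makes the final height exact, and as
  $\varepsilon \to 0$ the curve tends uniformly to $(at, bt, abt^2/2 + (c - ab/2)t)$, which stays
  inside the polydisc because $r \le 1$.\<close>
lemma legendrian_curve:
  fixes a b c :: complex
  assumes "r \<le> 1" "norm a < r" "norm b < r" "norm c < r"
  obtains X X' U U' Z where
    "\<And>t. (X has_field_derivative X' t) (at t)" "\<And>t. (U has_field_derivative U' t) (at t)"
    "\<And>t. (Z has_field_derivative U t * X' t) (at t)"
    "X 0 = 0" "U 0 = 0" "Z 0 = 0" "X 1 = a" "U 1 = b" "Z 1 = c"
    "\<And>s::real. s \<in> {0..1} \<Longrightarrow> norm (X (complex_of_real s)) < r \<and> norm (U (complex_of_real s)) < r \<and> norm (Z (complex_of_real s)) < r"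
proof -
  \<comment> \<open>The amplitude belonging to frequency 2 \<pi> (n + 1), scaled so that amplitude
    squared times frequency is 1. The shift by one excludes frequency zero.\<close>
  define e where "e n = 1 / sqrt (2 * pi * real (Suc n))" for n
  \<comment> \<open>The solution of
    \<open>a * b / 2 + b * e n + \<mu> n * (\<i> - a * e n) = c\<close>, whose left side is the
    height reached at time 1; \<open>\<mu>0\<close> is the limit for vanishing amplitude.\<close>
  define \<mu> where "\<mu> n = (c - a * b / 2 - b * e n) / (\<i> - a * e n)" for n
  define \<mu>0 where "\<mu>0 = (c - a * b / 2) / \<i>"
  \<comment> \<open>The margin between the largest coordinate of the end point and the radius; the
    oscillation errors are pushed below it.\<close>
  define \<delta> where "\<delta> = r - max (norm a) (max (norm b) (norm c))"
  have "\<delta> > 0" using assms by (simp add: \<delta>_def)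
  have lime: "e \<longlonglongrightarrow> 0"
  proof -
    have "filterlim (\<lambda>n. sqrt (2 * pi * real (Suc n))) at_top sequentially"
      by (intro filterlim_compose[OF sqrt_at_top] filterlim_tendsto_pos_mult_at_top[OF tendsto_const]
          filterlim_compose[OF filterlim_real_sequentially filterlim_Suc]) simp
    from tendsto_divide_0[OF tendsto_const filterlim_at_top_imp_at_infinity[OF this]]
    show ?thesis unfolding e_def .
  qed
  have lime': "(\<lambda>n. complex_of_real (e n)) \<longlonglongrightarrow> 0"
    using tendsto_of_real[OF lime] by simp
  have lim\<mu>: "\<mu> \<longlonglongrightarrow> \<mu>0"
    unfolding \<mu>_def \<mu>0_def by (rule tendsto_eq_intros lime' refl | simp)+
  have lim1: "(\<lambda>n. 2 * e n) \<longlonglongrightarrow> 0"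
    by (rule tendsto_eq_intros lime refl | simp)+
  have lim2: "(\<lambda>n. 2 * e n * norm (\<mu> n)) \<longlonglongrightarrow> 0"
    by (rule tendsto_eq_intros lime lim\<mu> refl | simp)+
  \<comment> \<open>These four summands bound the deviation of the height from its limiting
    parabola.\<close>
  have lim3: "(\<lambda>n. norm b * e n * (1 + 2 * (e n)\<^sup>2) + norm a * e n * norm (\<mu> n) * (1 + 2 * (e n)\<^sup>2)
     + norm (\<mu> n - \<mu>0) + 2 * (e n)\<^sup>2 * norm (\<mu> n)) \<longlonglongrightarrow> 0"
    by (rule tendsto_eq_intros lime lim\<mu> refl | simp)+
  \<comment> \<open>Eventually below 1, which keeps the denominator \<open>\<i> - a * e n\<close> of
    \<open>\<mu> n\<close> nonzero.\<close>
  have lim4: "(\<lambda>n. norm a * e n) \<longlonglongrightarrow> 0"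
    by (rule tendsto_eq_intros lime refl | simp)+
  have "\<forall>\<^sub>F n in sequentially. 2 * e n < \<delta> \<and> 2 * e n * norm (\<mu> n) < \<delta> \<and>
     norm b * e n * (1 + 2 * (e n)\<^sup>2) + norm a * e n * norm (\<mu> n) * (1 + 2 * (e n)\<^sup>2)
     + norm (\<mu> n - \<mu>0) + 2 * (e n)\<^sup>2 * norm (\<mu> n) < \<delta> \<and> norm a * e n < 1"
    using order_tendstoD(2)[OF lim1 \<open>\<delta> > 0\<close>] order_tendstoD(2)[OF lim2 \<open>\<delta> > 0\<close>] order_tendstoD(2)[OF lim3 \<open>\<delta> > 0\<close>]
       order_tendstoD(2)[OF lim4, of 1]
    by (simp add: eventually_conj_iff)
  then obtain n where n: "2 * e n < \<delta>" "2 * e n * norm (\<mu> n) < \<delta>"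
     "norm b * e n * (1 + 2 * (e n)\<^sup>2) + norm a * e n * norm (\<mu> n) * (1 + 2 * (e n)\<^sup>2)
     + norm (\<mu> n - \<mu>0) + 2 * (e n)\<^sup>2 * norm (\<mu> n) < \<delta>" "norm a * e n < 1"
    using eventually_happens'[OF sequentially_bot] by blast
  define \<epsilon> where "\<epsilon> = e n"
  define m where "m = \<mu> n"
  define \<omega> where "\<omega> = 2 * pi * real (Suc n)"
  have "\<epsilon> > 0" "\<omega> > 0" by (auto simp: \<epsilon>_def e_def \<omega>_def)
  have \<omega>\<epsilon>: "\<omega> * \<epsilon>\<^sup>2 = 1"
    using \<open>\<omega> > 0\<close> by (simp add: \<epsilon>_def e_def \<omega>_def power_divide)
  then have \<epsilon>2: "1 / \<omega> = \<epsilon>\<^sup>2" using \<open>\<omega> > 0\<close> by (simp add: field_simps)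
  define E where "E t = exp (\<i> * \<omega> * t)" for t
  define E' where "E' t = exp (- (\<i> * \<omega> * t))" for t
  have dE: "(E has_field_derivative \<i> * \<omega> * E t) (at t)" "(E' has_field_derivative - (\<i> * \<omega> * E' t)) (at t)" for t
    unfolding E_def E'_def by (auto intro!: derivative_eq_intros)
  have EE': "E t * E' t = 1" for t
    by (simp add: E_def E'_def exp_minus)
  have E0: "E 0 = 1" "E' 0 = 1" by (auto simp: E_def E'_def)
  have E1: "E 1 = 1"
  proof -
    have "\<i> * \<omega> * 1 = (2 * of_int (int (Suc n)) * pi) * \<i>" by (simp add: \<omega>_def)
    then show ?thesis unfolding E_def using exp_integer_2pi[of "of_int (int (Suc n))"] by (metis Ints_of_int)
  qed
  then have E1': "E' 1 = 1" using EE'[of 1] by simp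
  have nE: "norm (E (complex_of_real s)) = 1" "norm (E' (complex_of_real s)) = 1" for s
    by (simp_all add: E_def E'_def)
  have nE1: "norm (E (complex_of_real s) - 1) \<le> 2" "norm (E' (complex_of_real s) - 1) \<le> 2" for s
    using norm_triangle_ineq4[of "E (complex_of_real s)" 1] norm_triangle_ineq4[of "E' (complex_of_real s)" 1] nE[of s] by auto
  have iae: "\<i> - a * \<epsilon> \<noteq> 0"
  proof
    assume "\<i> - a * \<epsilon> = 0"
    then have "norm (a * \<epsilon>) = 1" by (metis eq_iff_diff_eq_0 norm_ii)
    then show False using n(4) \<open>\<epsilon> > 0\<close> by (simp add: norm_mult \<epsilon>_def)
  qed
  then have m: "m * (\<i> - a * \<epsilon>) = c - a * b / 2 - b * \<epsilon>"
    unfolding m_def \<mu>_def \<epsilon>_def by simp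
  define X where "X t = a * t + \<epsilon> * (E t - 1)" for t
  define X' where "X' t = a + \<epsilon> * (\<i> * \<omega> * E t)" for t
  define U where "U t = b * t + \<epsilon> * m * (E' t - 1)" for t
  define U' where "U' t = b - \<epsilon> * m * (\<i> * \<omega> * E' t)" for t
  \<comment> \<open>The antiderivative of \<open>U t * X' t\<close> vanishing at 0. As
    \<open>E t * E' t = 1\<close>, the product of the two oscillations leaves the drift
    \<open>\<i> * m * t\<close>; the factors \<open>\<epsilon>\<^sup>2\<close> come from dividing by
    \<open>\<omega>\<close> when the exponentials are integrated.\<close>
  define Z where "Z t = a * b * t\<^sup>2 / 2 + b * \<epsilon> * (t * E t + \<i> * \<epsilon>\<^sup>2 * (E t - 1))
      + a * \<epsilon> * m * (\<i> * \<epsilon>\<^sup>2 * (E' t - 1) - t) + \<i> * m * t - m * \<epsilon>\<^sup>2 * (E t - 1)" for t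
  have \<omega>\<epsilon>c: "complex_of_real \<omega> * (complex_of_real \<epsilon>)\<^sup>2 = 1"
    using \<omega>\<epsilon> by (metis of_real_1 of_real_mult of_real_power)
  show ?thesis
  proof (rule that[of X X' U U' Z])
    show "(X has_field_derivative X' t) (at t)" for t
      unfolding X_def X'_def by (auto intro!: derivative_eq_intros dE)
    show "(U has_field_derivative U' t) (at t)" for t
      unfolding U_def U'_def by (auto intro!: derivative_eq_intros dE)
    show "(Z has_field_derivative U t * X' t) (at t)" for t
    proof -
      let ?D = "a * b * t + b * \<epsilon> * (E t + t * (\<i> * \<omega> * E t) + \<i> * \<epsilon>\<^sup>2 * (\<i> * \<omega> * E t))
        + a * \<epsilon> * m * (\<i> * \<epsilon>\<^sup>2 * (- (\<i> * \<omega> * E' t)) - 1) + \<i> * m - m * \<epsilon>\<^sup>2 * (\<i> * \<omega> * E t)"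
      have "(Z has_field_derivative ?D) (at t)"
        unfolding Z_def by (rule derivative_eq_intros dE refl | simp add: algebra_simps)+
      moreover have "?D = U t * X' t"
        unfolding U_def X'_def of_real_power using EE'[of t] \<omega>\<epsilon>c i_squared by algebra
      ultimately show ?thesis by simp
    qed
    show "X 0 = 0" "U 0 = 0" "Z 0 = 0" "X 1 = a" "U 1 = b"
      by (simp_all add: X_def U_def Z_def E0 E1 E1')
    have "Z 1 = a * b / 2 + b * \<epsilon> + m * (\<i> - a * \<epsilon>)"
      by (simp add: Z_def E1 E1' algebra_simps)
    then show "Z 1 = c" unfolding m by simp
    fix s :: real assume s: "s \<in> {0..1}"
    let ?s = "complex_of_real s"
    have max: "norm a \<le> r - \<delta>" "norm b \<le> r - \<delta>" "norm c \<le> r - \<delta>" by (auto simp: \<delta>_def)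
    have le: "norm w * s \<le> norm w" for w :: complex using s by (simp add: mult_left_le)
    have "norm (X ?s) \<le> norm (a * ?s) + norm (\<epsilon> * (E ?s - 1))" unfolding X_def by (rule norm_triangle_ineq)
    also have "\<dots> \<le> norm a + \<epsilon> * 2"
      using s \<open>\<epsilon> > 0\<close> nE1[of s] le[of a] by (intro add_mono) (auto simp: norm_mult)
    also have "\<dots> < r" using n(1) max unfolding \<epsilon>_def by linarith
    finally have 1: "norm (X ?s) < r" .
    have "norm (U ?s) \<le> norm (b * ?s) + norm (\<epsilon> * m * (E' ?s - 1))" unfolding U_def by (rule norm_triangle_ineq)
    also have "\<dots> \<le> norm b + \<epsilon> * norm m * 2"
      using s \<open>\<epsilon> > 0\<close> nE1[of s] le[of b] by (intro add_mono) (auto simp: norm_mult intro!: mult_left_mono)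
    also have "\<dots> < r" using n(2) max unfolding \<epsilon>_def m_def by linarith
    finally have 2: "norm (U ?s) < r" .
    have c: "c = \<i> * \<mu>0 + a * b / 2" by (simp add: \<mu>0_def)
    \<comment> \<open>Limiting parabola plus errors. The quadratic part is
      \<open>- (a * b / 2) * s * (1 - s)\<close>, of modulus at most \<open>norm a * (1 - s)\<close>
      because \<open>norm b < 1\<close>. With the linear part it is thus dominated by a convex
      combination of \<open>norm c\<close> and \<open>norm a\<close>, hence by
      \<open>r - \<delta>\<close>.\<close>
    have "Z ?s = c * ?s + (- (a * b / 2)) * (?s * (1 - ?s)) + b * \<epsilon> * (?s * E ?s + \<i> * \<epsilon>\<^sup>2 * (E ?s - 1))
      + a * \<epsilon> * m * (\<i> * \<epsilon>\<^sup>2 * (E' ?s - 1) - ?s) + \<i> * (m - \<mu>0) * ?s - m * \<epsilon>\<^sup>2 * (E ?s - 1)"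
      unfolding Z_def by (subst c) (simp add: field_simps power2_eq_square)
    moreover have "norm (u1 + u2 + u3 + u4 + u5 - u6) \<le> norm u1 + norm u2 + norm u3 + norm u4 + norm u5 + norm u6"
      for u1 u2 u3 u4 u5 u6 :: complex
      by (intro order_trans[OF norm_triangle_ineq4] order_trans[OF norm_triangle_ineq] add_mono order_refl)
    ultimately have "norm (Z ?s) \<le> norm (c * ?s) + norm ((- (a * b / 2)) * (?s * (1 - ?s))) + norm (b * \<epsilon> * (?s * E ?s + \<i> * \<epsilon>\<^sup>2 * (E ?s - 1)))
      + norm (a * \<epsilon> * m * (\<i> * \<epsilon>\<^sup>2 * (E' ?s - 1) - ?s)) + norm (\<i> * (m - \<mu>0) * ?s) + norm (m * \<epsilon>\<^sup>2 * (E ?s - 1))"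
      by (simp only:)
    also have "\<dots> \<le> norm c * s + norm a * (1 - s) + norm b * \<epsilon> * (1 + \<epsilon>\<^sup>2 * 2) 
        + norm a * \<epsilon> * norm m * (\<epsilon>\<^sup>2 * 2 + 1) + norm (m - \<mu>0) + norm m * \<epsilon>\<^sup>2 * 2"
    proof (intro add_mono)
      show "norm (c * ?s) \<le> norm c * s" using s by (simp add: norm_mult)
      have "norm (?s * (1 - ?s)) = s * (1 - s)"
        using s by (metis abs_of_nonneg atLeastAtMost_iff diff_ge_0_iff_ge mult_nonneg_nonneg norm_of_real of_real_1 of_real_diff of_real_mult)
      moreover have "norm (a * b / 2) * (s * (1 - s)) \<le> norm a * (1 * (1 - s))"
      proof (intro mult_mono)
        have "norm a * norm b \<le> norm a * 1" using assms by (intro mult_left_mono) auto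
        then show "norm (a * b / 2) \<le> norm a"
          using norm_ge_zero[of a] by (simp add: norm_mult norm_divide del: norm_ge_zero)
      qed (use s in auto)
      ultimately show "norm (- (a * b / 2) * (?s * (1 - ?s))) \<le> norm a * (1 - s)"
        by (simp only: norm_mult norm_minus_cancel mult_1_left)
      have "norm (?s * E ?s + \<i> * \<epsilon>\<^sup>2 * (E ?s - 1)) \<le> norm (?s * E ?s) + norm (\<i> * \<epsilon>\<^sup>2 * (E ?s - 1))"
        by (rule norm_triangle_ineq)
      also have "\<dots> \<le> 1 + \<epsilon>\<^sup>2 * 2"
        using s nE1[of s] nE[of s] by (intro add_mono) (auto simp: norm_mult norm_power intro!: mult_left_mono)
      finally have "norm (?s * E ?s + \<i> * \<epsilon>\<^sup>2 * (E ?s - 1)) \<le> 1 + \<epsilon>\<^sup>2 * 2" .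
      then show "norm (b * \<epsilon> * (?s * E ?s + \<i> * \<epsilon>\<^sup>2 * (E ?s - 1))) \<le> norm b * \<epsilon> * (1 + \<epsilon>\<^sup>2 * 2)"
        using \<open>\<epsilon> > 0\<close> by (subst norm_mult, intro mult_mono) (auto simp: norm_mult)
      have "norm (\<i> * \<epsilon>\<^sup>2 * (E' ?s - 1) - ?s) \<le> norm (\<i> * \<epsilon>\<^sup>2 * (E' ?s - 1)) + norm ?s"
        by (rule norm_triangle_ineq4)
      also have "\<dots> \<le> \<epsilon>\<^sup>2 * 2 + 1"
        using s nE1[of s] by (intro add_mono) (auto simp: norm_mult norm_power intro!: mult_left_mono)
      finally have "norm (\<i> * \<epsilon>\<^sup>2 * (E' ?s - 1) - ?s) \<le> \<epsilon>\<^sup>2 * 2 + 1" .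
      then show "norm (a * \<epsilon> * m * (\<i> * \<epsilon>\<^sup>2 * (E' ?s - 1) - ?s)) \<le> norm a * \<epsilon> * norm m * (\<epsilon>\<^sup>2 * 2 + 1)"
        using \<open>\<epsilon> > 0\<close> by (subst norm_mult, intro mult_mono) (auto simp: norm_mult)
      show "norm (\<i> * (m - \<mu>0) * ?s) \<le> norm (m - \<mu>0)"
        using s le[of "m - \<mu>0"] by (simp add: norm_mult)
      show "norm (m * \<epsilon>\<^sup>2 * (E ?s - 1)) \<le> norm m * \<epsilon>\<^sup>2 * 2"
        using nE1[of s] by (auto simp: norm_mult norm_power intro!: mult_left_mono)
    qed
    also have "\<dots> < norm c * s + norm a * (1 - s) + \<delta>"
      using n(3) by (simp add: \<epsilon>_def m_def mult_ac add_ac)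
    also have "norm c * s + norm a * (1 - s) \<le> (r - \<delta>) * s + (r - \<delta>) * (1 - s)"
      using s max by (intro add_mono mult_right_mono) auto
    also have "\<dots> = r - \<delta>" by (simp add: algebra_simps)
    finally have 3: "norm (Z ?s) < r" by simp
    show "norm (X ?s) < r \<and> norm (U ?s) < r \<and> norm (Z ?s) < r" using 1 2 3 by blast
  qed
qed

section \<open>Local models of the distribution\<close>

text \<open>The map \<open>(x, y, z) \<mapsto> (x, y, Z (x, y, z))\<close> pulls \<open>dz - a dx - b dy\<close> back
  to \<open>D3 Z \<sqdot> (dz - f dx)\<close>.\<close>
lemma straightening:
  assumes a: "hol3 a S" and b: "hol3 b S" and "(0, 0, 0) \<in> S"
  obtains N V Z k f where "open N" "(0, 0, 0) \<in> N" "hol3 Z N" "hol3 f N" "hol3 k V"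
    "\<And>x y z. (x, y, z) \<in> N \<Longrightarrow> (x, y, Z (x, y, z)) \<in> V \<inter> S"
    "\<And>x y z. (x, y, z) \<in> N \<Longrightarrow> k (x, y, Z (x, y, z)) = z"
    "\<And>x y w. (x, y, w) \<in> V \<Longrightarrow> (x, y, k (x, y, w)) \<in> N \<and> Z (x, y, k (x, y, w)) = w"
    "\<And>x y z. (x, y, z) \<in> N \<Longrightarrow> D2 Z (x, y, z) = b (x, y, Z (x, y, z))"
    "\<And>x y z. (x, y, z) \<in> N \<Longrightarrow> D1 Z (x, y, z) + D3 Z (x, y, z) * f (x, y, z) = a (x, y, Z (x, y, z))"
    "Z (0, 0, 0) = 0" "\<And>q. q \<in> N \<Longrightarrow> D3 Z q \<noteq> 0"
proof -
  obtain r Z where r: "r > 0" "hol3 Z (polydisc r)"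
    "\<And>x y z. (x, y, z) \<in> polydisc r \<Longrightarrow> (x, y, Z (x, y, z)) \<in> S"
    "\<And>x z. (x, 0, z) \<in> polydisc r \<Longrightarrow> Z (x, 0, z) = z"
    "\<And>x y z. (x, y, z) \<in> polydisc r \<Longrightarrow> D2 Z (x, y, z) = b (x, y, Z (x, y, z))"
    by (rule hol3_ode[OF b assms(3)]) (rule that)
  have 0: "(0, 0, 0) \<in> polydisc r" using r(1) by simp
  \<comment> \<open>The initial condition makes \<open>Z\<close> the identity on the z-axis, so the
    straightening map is invertible near the origin.\<close>
  have "((\<lambda>t. Z (0, 0, t)) has_field_derivative 1) (at 0)"
    by (rule has_field_derivative_transform_within_open[of "\<lambda>t. t" _ _ "ball 0 r"]) (use r in \<open>auto\<close>)
  then have "D3 Z (0, 0, 0) = 1" by (simp add: D3_def DERIV_imp_deriv)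
  then have nz: "D3 Z (0, 0, 0) \<noteq> 0" by simp
  obtain N V k where N: "open N" "(0, 0, 0) \<in> N" "N \<subseteq> polydisc r" "hol3 k V" 
    "(\<lambda>(x, y, z). (x, y, Z (x, y, z))) ` N = V"
    "\<And>x y z. (x, y, z) \<in> N \<Longrightarrow> k (x, y, Z (x, y, z)) = z"
    "\<And>x y w. (x, y, w) \<in> V \<Longrightarrow> (x, y, k (x, y, w)) \<in> N \<and> Z (x, y, k (x, y, w)) = w"
    "\<And>q. q \<in> N \<Longrightarrow> D3 Z q \<noteq> 0"
    by (rule hol3_implicit_function[OF r(2) 0 nz]) (rule that)
  have Z: "hol3 Z N" using hol3_subset[OF r(2) N(3,1)] .
  \<comment> \<open>In the pulled-back form the dy term cancels by the differential equation for
    \<open>Z\<close>; dividing the dx coefficient by \<open>- D3 Z\<close> gives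
    \<open>f\<close>.\<close>
  define f where "f p = (a (fst p, fst (snd p), Z p) - D1 Z p) / D3 Z p" for p
  show ?thesis
  proof (rule that[of N Z f k V])
    show "hol3 f N"
      unfolding f_def using N(3) r(3)
      by (intro hol3_intros hol3_comp[OF a] hol3_D1 hol3_D3 Z N(1) N(8)) auto
    show "(x, y, Z (x, y, z)) \<in> V \<inter> S" if "(x, y, z) \<in> N" for x y z
      using that N(3) N(5)[symmetric] r(3) by (auto simp del: mem_ball intro!: rev_image_eqI)
    show "D2 Z (x, y, z) = b (x, y, Z (x, y, z))" if "(x, y, z) \<in> N" for x y z
      using that N(3) r(5) by blast
    show "D1 Z (x, y, z) + D3 Z (x, y, z) * f (x, y, z) = a (x, y, Z (x, y, z))" if "(x, y, z) \<in> N" for x y z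
      using N(8)[OF that] by (simp add: f_def)
    show "Z (0, 0, 0) = 0" using r(4) 0 by simp
  qed (use N Z in auto)
qed

text \<open>When \<open>f\<close> does not involve y, the condition dz = f dx is an ordinary
  differential equation in the (x, z)-plane. Its solutions, carried back by \<open>Z\<close>, sweep
  out integral surfaces labelled by their initial value \<eta>, and the first integral
  \<open>F\<close> reads off the label of the surface through a given point.\<close>

lemma exists_first_integral:
  assumes Z: "hol3 Z N" and f: "hol3 f N"
    and inS: "\<And>x y z. (x, y, z) \<in> N \<Longrightarrow> (x, y, Z (x, y, z)) \<in> S"
    and D2Z: "\<And>x y z. (x, y, z) \<in> N \<Longrightarrow> D2 Z (x, y, z) = b (x, y, Z (x, y, z))"
    and D1Z: "\<And>x y z. (x, y, z) \<in> N \<Longrightarrow> D1 Z (x, y, z) + D3 Z (x, y, z) * f (x, y, z) = a (x, y, Z (x, y, z))"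
    and Z0: "Z (0, 0, 0) = 0" and nz: "\<And>q. q \<in> N \<Longrightarrow> D3 Z q \<noteq> 0"
    and \<rho>: "\<rho> > 0" "polydisc \<rho> \<subseteq> N" and D2f: "\<And>q. q \<in> polydisc \<rho> \<Longrightarrow> D2 f q = 0"
  obtains F T where "hol3 F T" "(0, 0, 0) \<in> T" "T \<subseteq> S"
    "\<And>w. w \<in> T \<Longrightarrow> D3 F w \<noteq> 0 \<and> D1 F w = - a w * D3 F w \<and> D2 F w = - b w * D3 F w"
proof -
  have indep: "f (x, y, z) = f (x, 0, z)" if p: "(x, y, z) \<in> polydisc \<rho>" for x y z
  proof -
    have "((\<lambda>t. f (x, t, z)) has_field_derivative 0) (at t)" if "t \<in> ball 0 \<rho>" for t
    proof -
      have "(x, t, z) \<in> polydisc \<rho>" using p that by auto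
      then show ?thesis
        using hol3_partials(2)[OF f subsetD[OF \<rho>(2)], of x t z] D2f by simp
    qed
    then obtain c where "\<And>t. t \<in> ball 0 \<rho> \<Longrightarrow> f (x, t, z) = c"
      using has_field_derivative_zero_constant[of "ball 0 \<rho>" "\<lambda>t. f (x, t, z)"]
      by (metis convex_ball has_field_derivative_at_within)
    then show ?thesis using p \<rho> by simp
  qed
  \<comment> \<open>The solver \<open>hol3_ode\<close> differentiates in the middle variable, so x
    takes that place and the first slot is an idle variable, later set to 0.\<close>
  define S' where "S' = (\<lambda>p :: complex \<times> complex \<times> complex. (fst (snd p), 0::complex, snd (snd p))) -` polydisc \<rho>"
  have S': "p \<in> S' \<longleftrightarrow> fst (snd p) \<in> ball 0 \<rho> \<and> snd (snd p) \<in> ball 0 \<rho>" for p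
    using \<rho> by (auto simp: S'_def)
  have oS': "open S'" unfolding S'_def
    by (intro open_vimage open_polydisc0 continuous_intros)
  have g: "hol3 (\<lambda>p. f (fst (snd p), 0, snd (snd p))) S'"
    by (intro hol3_comp[OF f] hol3_intros oS' subsetD[OF \<rho>(2)]) (use \<rho> in \<open>auto simp: S'\<close>)
  have "(0, 0, 0) \<in> S'" using \<rho> by (simp add: S')
  then obtain r W where r: "r > 0" and W: "hol3 W (polydisc r)"
    "\<And>s x \<eta>. (s, x, \<eta>) \<in> polydisc r \<Longrightarrow> (s, x, W (s, x, \<eta>)) \<in> S'"
    "\<And>s \<eta>. (s, 0, \<eta>) \<in> polydisc r \<Longrightarrow> W (s, 0, \<eta>) = \<eta>"
    "\<And>s x \<eta>. (s, x, \<eta>) \<in> polydisc r \<Longrightarrow> D2 W (s, x, \<eta>) = f (fst (snd (s, x, W (s, x, \<eta>))), 0, snd (snd (s, x, W (s, x, \<eta>))))"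
    by (rule hol3_ode[OF g]) (rule that)
  \<comment> \<open>x and the label \<eta> range where the solution exists, y where \<open>f\<close>
    is known to be independent of y.\<close>
  define T where "T = ball (0::complex) r \<times> ball (0::complex) \<rho> \<times> ball (0::complex) r"
  have oT: "open T" unfolding T_def by (intro open_Times) auto
  have T: "(0, x, \<eta>) \<in> polydisc r" "(x, y, W (0, x, \<eta>)) \<in> polydisc \<rho>" if "(x, y, \<eta>) \<in> T" for x y \<eta>
  proof -
    show 1: "(0, x, \<eta>) \<in> polydisc r" using that r by (auto simp: T_def)
    show "(x, y, W (0, x, \<eta>)) \<in> polydisc \<rho>" using that W(2)[OF 1] by (auto simp: T_def S')
  qed
  define w where "w p = W (0, fst p, snd (snd p))" for p :: "complex \<times> complex \<times> complex"
  \<comment> \<open>For fixed \<eta>, the graph of \<open>m\<close> over the (x, y)-plane is one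
    leaf: its slopes are exactly \<open>a\<close> and \<open>b\<close>.\<close>
  define m where "m p = Z (fst p, fst (snd p), w p)" for p
  have w: "hol3 w T"
    unfolding w_def by (intro hol3_comp[OF W(1)] hol3_intros oT) (use T in auto)
  have m: "hol3 m T"
    unfolding m_def using \<rho>(2) T(2) by (intro hol3_comp[OF Z] hol3_intros oT w) (auto simp: w_def)
  have Dm: "D1 m (x, y, \<eta>) = a (x, y, m (x, y, \<eta>))" "D2 m (x, y, \<eta>) = b (x, y, m (x, y, \<eta>))"
     "D3 m (x, y, \<eta>) = D3 Z (x, y, w (x, y, \<eta>)) * D3 W (0, x, \<eta>)"
    if p: "(x, y, \<eta>) \<in> T" for x y \<eta>
  proof -
    note W0 = hol3_partials[OF W(1) T(1)[OF p]]
    have q: "(x, y, w (x, y, \<eta>)) \<in> polydisc \<rho>" using T(2)[OF p] by (simp add: w_def)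
    then have qN: "(x, y, w (x, y, \<eta>)) \<in> N" using \<rho> by blast
    have "((\<lambda>t. Z (t, y, W (0, t, \<eta>))) has_field_derivative
       D1 Z (x, y, W (0, x, \<eta>)) * 1 + D2 Z (x, y, W (0, x, \<eta>)) * 0 + D3 Z (x, y, W (0, x, \<eta>)) * D2 W (0, x, \<eta>)) (at x)"
      by (rule hol3_chain[OF Z]) (use qN W0 in \<open>auto simp: w_def\<close>)
    then have "D1 m (x, y, \<eta>) = D1 Z (x, y, w (x, y, \<eta>)) + D3 Z (x, y, w (x, y, \<eta>)) * D2 W (0, x, \<eta>)"
      by (auto simp: D1_def[of m] m_def w_def DERIV_imp_deriv)
    also have "D2 W (0, x, \<eta>) = f (x, y, w (x, y, \<eta>))"
      using W(4)[OF T(1)[OF p]] indep[OF q] by (simp add: w_def)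
    finally show "D1 m (x, y, \<eta>) = a (x, y, m (x, y, \<eta>))"
      using D1Z[OF qN] by (simp add: m_def[of "(x, y, \<eta>)"])
    have "((\<lambda>t. Z (x, t, W (0, x, \<eta>))) has_field_derivative D2 Z (x, y, w (x, y, \<eta>))) (at y)"
      using hol3_partials(2)[OF Z qN] by (simp add: w_def)
    then have "D2 m (x, y, \<eta>) = D2 Z (x, y, w (x, y, \<eta>))"
      by (auto simp: D2_def[of m] m_def w_def DERIV_imp_deriv)
    then show "D2 m (x, y, \<eta>) = b (x, y, m (x, y, \<eta>))"
      using D2Z[OF qN] by (simp add: m_def[of "(x, y, \<eta>)"])
    have "((\<lambda>t. Z (x, y, W (0, x, t))) has_field_derivative
       D1 Z (x, y, W (0, x, \<eta>)) * 0 + D2 Z (x, y, W (0, x, \<eta>)) * 0 + D3 Z (x, y, W (0, x, \<eta>)) * D3 W (0, x, \<eta>)) (at \<eta>)"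
      by (rule hol3_chain[OF Z]) (use qN W0 in \<open>auto simp: w_def\<close>)
    then show "D3 m (x, y, \<eta>) = D3 Z (x, y, w (x, y, \<eta>)) * D3 W (0, x, \<eta>)"
      by (auto simp: D3_def[of m] m_def w_def DERIV_imp_deriv)
  qed
  have T0: "(0, 0, 0) \<in> T" using r \<rho> by (simp add: T_def)
  have W0: "W (0, 0, \<eta>) = \<eta>" if "\<eta> \<in> ball 0 r" for \<eta> using W(3)[of 0 \<eta>] that r by simp
  have "((\<lambda>t. W (0, 0, t)) has_field_derivative 1) (at 0)"
    by (rule has_field_derivative_transform_within_open[of "\<lambda>t. t" _ _ "ball 0 r"]) (use W0 r in \<open>auto\<close>)
  then have "D3 W (0, 0, 0) = 1" by (simp add: D3_def DERIV_imp_deriv)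
  moreover have "(0, 0, 0) \<in> N" using \<rho> by auto
  moreover have w0: "w (0, 0, 0) = 0" using W0[of 0] r by (simp add: w_def)
  ultimately have nz0: "D3 m (0, 0, 0) \<noteq> 0" using Dm(3)[OF T0] nz by simp
  obtain M V F where M: "open M" "(0, 0, 0) \<in> M" "M \<subseteq> T" "hol3 F V" 
    "(\<lambda>(x, y, z). (x, y, m (x, y, z))) ` M = V"
    "\<And>x y z. (x, y, z) \<in> M \<Longrightarrow> F (x, y, m (x, y, z)) = z"
    "\<And>x y w. (x, y, w) \<in> V \<Longrightarrow> (x, y, F (x, y, w)) \<in> M \<and> m (x, y, F (x, y, w)) = w"
    "\<And>q. q \<in> M \<Longrightarrow> D3 m q \<noteq> 0"
    by (rule hol3_implicit_function[OF m T0 nz0]) (rule that)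
  show ?thesis
  proof (rule that[of F V])
    have "m (0, 0, 0) = 0" using w0 Z0 by (simp add: m_def)
    then show "(0, 0, 0) \<in> V"
      using M(2) M(5)[symmetric] by (auto intro!: rev_image_eqI)
    show "V \<subseteq> S"
    proof
      fix q assume "q \<in> V"
      then obtain x y \<eta> where *: "q = (x, y, m (x, y, \<eta>))" "(x, y, \<eta>) \<in> M" using M(5) by auto
      then have "(x, y, w (x, y, \<eta>)) \<in> N" using subsetD[OF \<rho>(2) T(2)] M(3) by (auto simp: w_def)
      then show "q \<in> S" using inS * by (simp add: m_def)
    qed
    fix q assume "q \<in> V"
    obtain x y z where q: "q = (x, y, z)" by (cases q)
    define \<eta> where "\<eta> = F (x, y, z)"
    have V: "(x, y, z) \<in> V" using \<open>q \<in> V\<close> q by simp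
    have p: "(x, y, \<eta>) \<in> M" and mz: "m (x, y, \<eta>) = z" using M(7)[OF V] by (auto simp: \<eta>_def)
    have pT: "(x, y, \<eta>) \<in> T" using p M(3) by blast
    note mD = hol3_partials[OF m pT]
    have mV: "(x, y, m (x, y, \<eta>)) \<in> V" using V mz by simp
    obtain s where "s > 0" and s: "cball x s \<times> cball y s \<times> cball \<eta> s \<subseteq> M"
      using open_polydisc[OF M(1) p] by metis
    \<comment> \<open>Differentiating the identity F(x, y, m(x, y, \<eta>)) = \<eta> in x, y and
      \<eta> in turn: the first two give the ratios of the partials of \<open>F\<close>, the third
      shows \<open>D3 F\<close> to be nonzero.\<close>
    have "((\<lambda>t. F (t, y, m (t, y, \<eta>))) has_field_derivative D1 F q * 1 + D2 F q * 0 + D3 F q * D1 m (x, y, \<eta>)) (at x)"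
      unfolding q mz[symmetric] by (rule hol3_chain[OF M(4)]) (use mD mV in \<open>auto simp: mz\<close>)
    moreover have "((\<lambda>t. F (t, y, m (t, y, \<eta>))) has_field_derivative 0) (at x)"
      by (rule has_field_derivative_transform_within_open[of "\<lambda>t. \<eta>" _ _ "ball x s"])
         (use s \<open>s > 0\<close> in \<open>auto intro!: M(6)[symmetric]\<close>)
    ultimately have 1: "D1 F q + D3 F q * D1 m (x, y, \<eta>) = 0" using DERIV_unique by force
    have "((\<lambda>t. F (x, t, m (x, t, \<eta>))) has_field_derivative D1 F q * 0 + D2 F q * 1 + D3 F q * D2 m (x, y, \<eta>)) (at y)"
      unfolding q mz[symmetric] by (rule hol3_chain[OF M(4)]) (use mD mV in \<open>auto simp: mz\<close>)
    moreover have "((\<lambda>t. F (x, t, m (x, t, \<eta>))) has_field_derivative 0) (at y)"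
      by (rule has_field_derivative_transform_within_open[of "\<lambda>t. \<eta>" _ _ "ball y s"])
         (use s \<open>s > 0\<close> in \<open>auto intro!: M(6)[symmetric]\<close>)
    ultimately have 2: "D2 F q + D3 F q * D2 m (x, y, \<eta>) = 0" using DERIV_unique by force
    have "((\<lambda>t. F (x, y, m (x, y, t))) has_field_derivative D1 F q * 0 + D2 F q * 0 + D3 F q * D3 m (x, y, \<eta>)) (at \<eta>)"
      unfolding q mz[symmetric] by (rule hol3_chain[OF M(4)]) (use mD mV in \<open>auto simp: mz\<close>)
    moreover have "((\<lambda>t. F (x, y, m (x, y, t))) has_field_derivative 1) (at \<eta>)"
      by (rule has_field_derivative_transform_within_open[of "\<lambda>t. t" _ _ "ball \<eta> s"])
         (use s \<open>s > 0\<close> in \<open>auto intro!: M(6)[symmetric]\<close>)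
    ultimately have 3: "D3 F q * D3 m (x, y, \<eta>) = 1" using DERIV_unique by force
    show "D3 F q \<noteq> 0 \<and> D1 F q = - a q * D3 F q \<and> D2 F q = - b q * D3 F q"
      using 1 2 3 Dm[OF pT] by (auto simp: mz q add_eq_0_iff mult.commute)
  qed (rule M)
qed

text \<open>Where \<open>D2 f \<noteq> 0\<close>, the triple \<open>(x, u, z)\<close> with \<open>u = f (x, y, z)\<close> is a coordinate
  system in which the distribution is the contact distribution \<open>dz = u dx\<close>.\<close>
lemma exists_reachable_neighbourhood:
  assumes Z: "hol3 Z N" and f: "hol3 f N" and k: "hol3 k V"
    and inV: "\<And>x y z. (x, y, z) \<in> N \<Longrightarrow> (x, y, Z (x, y, z)) \<in> V"
    and inS: "\<And>x y z. (x, y, z) \<in> N \<Longrightarrow> (x, y, Z (x, y, z)) \<in> S"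
    and kZ: "\<And>x y z. (x, y, z) \<in> N \<Longrightarrow> k (x, y, Z (x, y, z)) = z"
    and Zk: "\<And>x y w. (x, y, w) \<in> V \<Longrightarrow> (x, y, k (x, y, w)) \<in> N \<and> Z (x, y, k (x, y, w)) = w"
    and D2Z: "\<And>x y z. (x, y, z) \<in> N \<Longrightarrow> D2 Z (x, y, z) = b (x, y, Z (x, y, z))"
    and D1Z: "\<And>x y z. (x, y, z) \<in> N \<Longrightarrow> D1 Z (x, y, z) + D3 Z (x, y, z) * f (x, y, z) = a (x, y, Z (x, y, z))"
    and q: "(x1, y1, z1) \<in> N" and D2f: "D2 f (x1, y1, z1) \<noteq> 0"
  obtains w0 U where "open U" "w0 \<in> U" 
    "\<And>w. w \<in> U \<Longrightarrow> \<exists>x y z x' y' \<Omega>. open \<Omega> \<and> complex_of_real ` {0..1} \<subseteq> \<Omega> \<and> (x 0, y 0, z 0) = w0 \<and> (x 1, y 1, z 1) = w \<and>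
      (\<forall>t\<in>\<Omega>. (x t, y t, z t) \<in> U \<inter> S \<and> (x has_field_derivative x' t) (at t) \<and> (y has_field_derivative y' t) (at t) \<and>
        (z has_field_derivative a (x t, y t, z t) * x' t + b (x t, y t, z t) * y' t) (at t))"
proof -
  \<comment> \<open>The implicit function lemma solves for the last coordinate, but here y is to be
    recovered from u; so y and z trade places and \<open>\<phi>\<close> takes (x, z, u) to
    y.\<close>
  let ?\<sigma> = "\<lambda>(x, y, z). (x, z, y)"
  define f' where "f' = (\<lambda>(x, z, y). f (x, y, z))"
  have f': "hol3 f' (?\<sigma> -` N)" unfolding f'_def by (rule hol3_permute(2)[OF f])
  have q': "(x1, z1, y1) \<in> ?\<sigma> -` N" using q by simp
  have D3f': "D3 f' (x1, z1, y1) \<noteq> 0" using D2f by (simp add: D3_def D2_def f'_def)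
  obtain N' V' \<phi> where N': "open N'" "(x1, z1, y1) \<in> N'" "N' \<subseteq> ?\<sigma> -` N" "hol3 \<phi> V'" 
    "(\<lambda>(x, y, z). (x, y, f' (x, y, z))) ` N' = V'"
    "\<And>x y z. (x, y, z) \<in> N' \<Longrightarrow> \<phi> (x, y, f' (x, y, z)) = z"
    "\<And>x y w. (x, y, w) \<in> V' \<Longrightarrow> (x, y, \<phi> (x, y, w)) \<in> N' \<and> f' (x, y, \<phi> (x, y, w)) = w"
    "\<And>q. q \<in> N' \<Longrightarrow> D3 f' q \<noteq> 0"
    by (rule hol3_implicit_function[OF f' q' D3f']) (rule that)
  define u1 where "u1 = f (x1, y1, z1)"
  have "(x1, z1, u1) \<in> V'" using N'(2) N'(5)[symmetric] by (auto simp: u1_def f'_def intro!: rev_image_eqI)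
  then obtain R where "R > 0" and R: "cball x1 R \<times> cball z1 R \<times> cball u1 R \<subseteq> V'"
    using open_polydisc[OF hol3_open[OF N'(4)]] by metis
  \<comment> \<open>The shear in \<open>C\<close> can enlarge the z-extent by the factor
    \<open>1 + norm u1\<close>, hence the quotient; the bound 1 is what
    \<open>legendrian_curve\<close> requires.\<close>
  define r where "r = min 1 (R / (1 + norm u1))"
  have pos: "1 + norm u1 > 0" using norm_ge_zero[of u1] by linarith
  have "r \<le> R / (1 + norm u1)" by (simp add: r_def)
  then have r: "r * (1 + norm u1) \<le> R" "r > 0" "r \<le> 1"
    using \<open>R > 0\<close> pos by (simp add: pos_le_divide_eq, auto simp: r_def)
  have "r \<le> r * (1 + norm u1)" using r by (simp add: distrib_left)
  then have "r \<le> R" using r(1) by (rule order_trans)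
  \<comment> \<open>A polydisc in X = x - x1, Y = u - u1, Q = z - z1 - u1 (x - x1). This change of
    variables turns dz = u dx into dQ = Y dX, so curves starting at the origin suffice.\<close>
  define C where "C = {(x, z, u). norm (x - x1) < r \<and> norm (u - u1) < r \<and> norm (z - z1 - u1 * (x - x1)) < r}"
  have oC: "open C" unfolding C_def split_beta'
    by (intro open_Collect_conj open_Collect_less continuous_intros)
  have CV: "C \<subseteq> V'"
  proof
    fix p assume "p \<in> C"
    then obtain x z u where p: "p = (x, z, u)" and *: "norm (x - x1) < r" "norm (u - u1) < r" "norm (z - z1 - u1 * (x - x1)) < r"
      by (auto simp: C_def)
    have "norm (z - z1) \<le> norm (z - z1 - u1 * (x - x1)) + norm (u1 * (x - x1))"
      using norm_triangle_ineq[of "z - z1 - u1 * (x - x1)" "u1 * (x - x1)"] by simp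
    also have "\<dots> \<le> r + norm u1 * r" using * by (intro add_mono) (auto simp: norm_mult intro: mult_left_mono)
    also have "\<dots> \<le> R" using r by (simp add: algebra_simps)
    finally have "norm (z - z1) \<le> R" .
    then have "p \<in> cball x1 R \<times> cball z1 R \<times> cball u1 R"
      using * \<open>r \<le> R\<close> by (simp add: p dist_norm norm_minus_commute)
    then show "p \<in> V'" using R by blast
  qed
  \<comment> \<open>This is the image of \<open>C\<close> under the parametrisation \<open>G\<close>
    below, written as a preimage so that openness follows from continuity.\<close>
  define U where "U = {w \<in> V. (fst w, k w, fst (snd w)) \<in> N' \<and> (fst w, k w, f (fst w, fst (snd w), k w)) \<in> C}"
  have oU: "open U"
  proof -
    have ck: "continuous_on V k" by (rule hol3_continuous[OF k])
    let ?\<psi> = "\<lambda>w. (fst w, k w, fst (snd w))"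
    have 1: "open (V \<inter> ?\<psi> -` N')"
      by (intro continuous_open_preimage continuous_intros ck hol3_open[OF k] N'(1))
    let ?\<chi> = "\<lambda>w. (fst w, k w, f (fst w, fst (snd w), k w))"
    have "continuous_on (V \<inter> ?\<psi> -` N') (\<lambda>w. f (fst w, fst (snd w), k w))"
      using Zk by (intro continuous_on_compose2[OF hol3_continuous[OF f]] continuous_intros continuous_on_subset[OF ck]) auto
    then have "open (V \<inter> ?\<psi> -` N' \<inter> ?\<chi> -` C)"
      by (intro continuous_open_preimage continuous_intros continuous_on_subset[OF ck] 1 oC) auto
    moreover have "U = V \<inter> ?\<psi> -` N' \<inter> ?\<chi> -` C" by (auto simp: U_def)
    ultimately show ?thesis by simp
  qed
  define G where "G = (\<lambda>(x, z, u). (x, \<phi> (x, z, u), Z (x, \<phi> (x, z, u), z)))"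
  have C: "(x, \<phi> (x, z, u), z) \<in> N" "f (x, \<phi> (x, z, u), z) = u" "G (x, z, u) \<in> U" if c: "(x, z, u) \<in> C" for x z u
  proof -
    have 1: "(x, z, \<phi> (x, z, u)) \<in> N'" "f' (x, z, \<phi> (x, z, u)) = u" using N'(7) c CV by blast+
    then show 2: "(x, \<phi> (x, z, u), z) \<in> N" using N'(3) by auto
    show 3: "f (x, \<phi> (x, z, u), z) = u" using 1 by (simp add: f'_def)
    show "G (x, z, u) \<in> U" unfolding U_def G_def using inV[OF 2] kZ[OF 2] 3 c 1 by simp
  qed
  have c1: "(x1, z1, u1) \<in> C" using r by (simp add: C_def)
  show ?thesis
  proof (rule that[OF oU C(3)[OF c1]])
    fix w assume "w \<in> U"
    obtain x2 y2 w2 where w: "w = (x2, y2, w2)" by (cases w)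
    define z2 where "z2 = k w"
    define u2 where "u2 = f (x2, y2, z2)"
    have wU: "(x2, y2, w2) \<in> V" "(x2, z2, y2) \<in> N'" "(x2, z2, u2) \<in> C"
      using \<open>w \<in> U\<close> by (auto simp: U_def w z2_def u2_def)
    have Zw: "Z (x2, y2, z2) = w2" using Zk[OF wU(1)] by (simp add: z2_def w)
    have "\<phi> (x2, z2, u2) = y2" using N'(6)[OF wU(2)] by (simp add: f'_def u2_def)
    then have Gw: "G (x2, z2, u2) = w" using Zw by (simp add: G_def w)
    have wU': "norm (x2 - x1) < r" "norm (u2 - u1) < r" "norm (z2 - z1 - u1 * (x2 - x1)) < r"
      using wU(3) by (simp_all add: C_def)
    obtain X X' Y Y' Q where
      X: "\<And>t. (X has_field_derivative X' t) (at t)" and Y: "\<And>t. (Y has_field_derivative Y' t) (at t)" and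
      Q: "\<And>t. (Q has_field_derivative Y t * X' t) (at t)" and 
      ends: "X 0 = 0" "Y 0 = 0" "Q 0 = 0" "X 1 = x2 - x1" "Y 1 = u2 - u1" "Q 1 = z2 - z1 - u1 * (x2 - x1)" and
      bd: "\<And>s::real. s \<in> {0..1} \<Longrightarrow> norm (X (complex_of_real s)) < r \<and> norm (Y (complex_of_real s)) < r \<and> norm (Q (complex_of_real s)) < r"
      by (rule legendrian_curve[OF r(3) wU'(1,2,3)]) (rule that)
    \<comment> \<open>Undoes the translation and the shear; the added term \<open>u1 * X t\<close>
      in \<open>z\<close> restores z' = u x'.\<close>
    define x where "x t = x1 + X t" for t
    define u where "u t = u1 + Y t" for t
    define z where "z t = z1 + u1 * X t + Q t" for t
    \<comment> \<open>The contact coordinates prescribe y implicitly through f(x, y, z) = u; this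
      makes z' = f x' hold along the lifted curve.\<close>
    define y where "y t = \<phi> (x t, z t, u t)" for t
    define y' where "y' t = D1 \<phi> (x t, z t, u t) * X' t + D2 \<phi> (x t, z t, u t) * (u t * X' t) + D3 \<phi> (x t, z t, u t) * Y' t" for t
    define \<Omega> where "\<Omega> = {t. (x t, z t, u t) \<in> C}"
    have dx: "(x has_field_derivative X' t) (at t)" for t
      unfolding x_def by (auto intro!: derivative_eq_intros X)
    have du: "(u has_field_derivative Y' t) (at t)" for t
      unfolding u_def by (auto intro!: derivative_eq_intros Y)
    have dz: "(z has_field_derivative u t * X' t) (at t)" for t
      unfolding z_def u_def by (auto intro!: derivative_eq_intros X Q simp: algebra_simps)
    have cont: "continuous_on UNIV x" "continuous_on UNIV u" "continuous_on UNIV z"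
      using dx du dz by (auto intro!: continuous_at_imp_continuous_on DERIV_isCont)
    have "\<Omega> = (\<lambda>t. (x t, z t, u t)) -` C" by (auto simp: \<Omega>_def)
    then have o\<Omega>: "open \<Omega>" using cont oC by (auto intro!: open_vimage continuous_intros)
    show "\<exists>x y z x' y' \<Omega>. open \<Omega> \<and> complex_of_real ` {0..1} \<subseteq> \<Omega> \<and> (x 0, y 0, z 0) = G (x1, z1, u1) \<and> (x 1, y 1, z 1) = w \<and>
      (\<forall>t\<in>\<Omega>. (x t, y t, z t) \<in> U \<inter> S \<and> (x has_field_derivative x' t) (at t) \<and> (y has_field_derivative y' t) (at t) \<and>
        (z has_field_derivative a (x t, y t, z t) * x' t + b (x t, y t, z t) * y' t) (at t))"
    proof (intro exI conjI ballI)
      show "open \<Omega>" by (rule o\<Omega>)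
      show "complex_of_real ` {0..1} \<subseteq> \<Omega>"
        using bd by (auto simp: \<Omega>_def C_def x_def u_def z_def)
      show "(x 0, y 0, (\<lambda>t. Z (x t, y t, z t)) 0) = G (x1, z1, u1)"
        by (simp add: y_def G_def x_def u_def z_def ends)
      have "x 1 = x2" "u 1 = u2" "z 1 = z2" by (simp_all add: x_def u_def z_def ends)
      then show "(x 1, y 1, (\<lambda>t. Z (x t, y t, z t)) 1) = w"
        using Gw by (simp add: y_def G_def)
      fix t assume "t \<in> \<Omega>"
      then have c: "(x t, z t, u t) \<in> C" by (simp add: \<Omega>_def)
      have inN: "(x t, y t, z t) \<in> N" and fu: "f (x t, y t, z t) = u t" using C[OF c] by (auto simp: y_def)
      show "(x t, y t, (\<lambda>t. Z (x t, y t, z t)) t) \<in> U \<inter> S"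
        using C(3)[OF c] inS[OF inN] by (simp add: G_def y_def)
      show "(x has_field_derivative X' t) (at t)" by (rule dx)
      show dy: "(y has_field_derivative y' t) (at t)"
        unfolding y_def[abs_def] y'_def
        by (rule hol3_chain[OF N'(4)]) (use c CV dx dz du in auto)
      have "((\<lambda>t. Z (x t, y t, z t)) has_field_derivative
         D1 Z (x t, y t, z t) * X' t + D2 Z (x t, y t, z t) * y' t + D3 Z (x t, y t, z t) * (u t * X' t)) (at t)"
        by (rule hol3_chain[OF Z inN dx dy dz])
      moreover have "D1 Z (x t, y t, z t) * X' t + D2 Z (x t, y t, z t) * y' t + D3 Z (x t, y t, z t) * (u t * X' t)
        = a (x t, y t, Z (x t, y t, z t)) * X' t + b (x t, y t, Z (x t, y t, z t)) * y' t"
        using D1Z[OF inN, symmetric] D2Z[OF inN] by (simp add: fu algebra_simps)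
      ultimately show "((\<lambda>t. Z (x t, y t, z t)) has_field_derivative
         a (x t, y t, (\<lambda>t. Z (x t, y t, z t)) t) * X' t + b (x t, y t, (\<lambda>t. Z (x t, y t, z t)) t) * y' t) (at t)"
        by simp
    qed
  qed
qed

section \<open>Transfer to the distribution\<close>

text \<open>Affine coordinates centred at \<open>p\<close>: component \<open>j\<close> plays x,
  component \<open>k\<close> plays y, and the final branch gives z to the one remaining
  index.\<close>

definition chart :: "complex^3 \<Rightarrow> 3 \<Rightarrow> 3 \<Rightarrow> complex \<times> complex \<times> complex \<Rightarrow> complex^3" where
  "chart p j k q = p + (\<chi> l. if l = j then fst q else if l = k then fst (snd q) else snd (snd q))"

definition coords :: "complex^3 \<Rightarrow> 3 \<Rightarrow> 3 \<Rightarrow> 3 \<Rightarrow> complex^3 \<Rightarrow> complex \<times> complex \<times> complex" where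
  "coords p j k i v = (v $ j - p $ j, v $ k - p $ k, v $ i - p $ i)"

lemma chart_coords:
  assumes "UNIV = {i, j, k :: 3}" "i \<noteq> j" "i \<noteq> k" "j \<noteq> k"
  shows "chart p j k (coords p j k i v) = v" "coords p j k i (chart p j k q) = q"
proof -
  have "l = i" if "l \<noteq> j" "l \<noteq> k" for l using assms(1) that by blast
  then show "chart p j k (coords p j k i v) = v"
    by (auto simp: chart_def coords_def vec_eq_iff)
  show "coords p j k i (chart p j k q) = q"
    using assms by (cases q) (auto simp: chart_def coords_def)
qed

lemma chart_nth:
  assumes "i \<noteq> j" "i \<noteq> k" "j \<noteq> k"
  shows "chart p j k q $ j = p $ j + fst q" "chart p j k q $ k = p $ k + fst (snd q)"
    "chart p j k q $ i = p $ i + snd (snd q)"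
  using assms by (auto simp: chart_def)

lemma chart_has_derivative:
  "(chart p j k has_derivative (\<lambda>q. \<chi> l. if l = j then fst q else if l = k then fst (snd q) else snd (snd q))) (at q)"
proof -
  have "linear (\<lambda>q::complex \<times> complex \<times> complex. \<chi> l. if l = j then fst q else if l = k then fst (snd q) else snd (snd q))"
    by (auto simp: linear_iff vec_eq_iff)
  then have "bounded_linear (\<lambda>q::complex \<times> complex \<times> complex. \<chi> l. if l = j then fst q else if l = k then fst (snd q) else snd (snd q))"
    by (simp add: linear_conv_bounded_linear)
  from bounded_linear_imp_has_derivative[OF this] show ?thesis
    unfolding chart_def[abs_def] by (auto intro!: derivative_eq_intros)
qed

lemma continuous_on_chart: "continuous_on S (chart p j k)"
  by (intro has_derivative_continuous_on[OF has_derivative_at_withinI[OF chart_has_derivative]])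

lemma coords_has_derivative: "(coords p j k i has_derivative (\<lambda>v. (v $ j, v $ k, v $ i))) (at v)"
  unfolding coords_def[abs_def]
  by (auto intro!: derivative_eq_intros bounded_linear_imp_has_derivative[OF bounded_linear_vec_nth])

lemma continuous_on_coords: "continuous_on S (coords p j k i)"
  by (intro has_derivative_continuous_on[OF has_derivative_at_withinI[OF coords_has_derivative]])

lemma hol3_chart:
  assumes "holo3 g V" 
  shows "hol3 (\<lambda>q. g (chart p j k q)) (chart p j k -` V)"
  unfolding hol3_def
proof (intro conjI ballI)
  show "open (chart p j k -` V)"
    using assms by (auto simp: holo3_def intro!: open_vimage continuous_on_chart)
  fix q assume "q \<in> chart p j k -` V"
  then obtain L where L: "(g has_derivative L) (at (chart p j k q))" "\<And>(c::complex) v. L (c *s v) = c * L v"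
    using assms unfolding holo3_def by blast
  \<comment> \<open>Indicator vectors of the three branches of \<open>chart\<close>; phrased with
    predicates, the decomposition holds for any \<open>j\<close> and \<open>k\<close>.\<close>
  define e where "e P = ((\<chi> l. if P l then 1 else 0) :: complex ^ 3)" for P :: "3 \<Rightarrow> bool"
  interpret L: bounded_linear L using L(1) by (rule has_derivative_bounded_linear)
  have *: "(\<chi> l. if l = j then u else if l = k then v else w) = u *s e (\<lambda>l. l = j) + v *s e (\<lambda>l. l \<noteq> j \<and> l = k) + w *s e (\<lambda>l. l \<noteq> j \<and> l \<noteq> k)"
    for u v w by (auto simp: e_def vec_eq_iff)
  from has_derivative_compose[OF chart_has_derivative L(1)]
  have "((\<lambda>q. g (chart p j k q)) has_derivative (\<lambda>q. fst q * L (e (\<lambda>l. l = j)) 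
     + fst (snd q) * L (e (\<lambda>l. l \<noteq> j \<and> l = k)) + snd (snd q) * L (e (\<lambda>l. l \<noteq> j \<and> l \<noteq> k)))) (at q)"
    by (simp only: * L.add L(2))
  then show "\<exists>a b c. ((\<lambda>q. g (chart p j k q)) has_derivative (\<lambda>(u, v, w). a * u + b * v + c * w)) (at q)"
    by (intro exI[of _ "L (e (\<lambda>l. l = j))"] exI[of _ "L (e (\<lambda>l. l \<noteq> j \<and> l = k))"] exI[of _ "L (e (\<lambda>l. l \<noteq> j \<and> l \<noteq> k))"])
       (simp add: split_beta' mult.commute)
qed

lemma has_derivative_coords:
  assumes "hol3 F T" "coords p j k i v \<in> T"
  shows "((\<lambda>v. F (coords p j k i v)) has_derivative
     (\<lambda>h. D1 F (coords p j k i v) * h $ j + D2 F (coords p j k i v) * h $ k + D3 F (coords p j k i v) * h $ i)) (at v)"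
  using has_derivative_compose[OF coords_has_derivative hol3_has_derivative[OF assms]] by simp

lemma holo3_coords:
  assumes "hol3 F T"
  shows "holo3 (\<lambda>v. F (coords p j k i v)) (coords p j k i -` T)"
  unfolding holo3_def
proof (intro conjI ballI)
  show "open (coords p j k i -` T)"
    using hol3_open[OF assms] by (intro open_vimage continuous_on_coords)
  fix v assume v: "v \<in> coords p j k i -` T"
  show "\<exists>L. ((\<lambda>v. F (coords p j k i v)) has_derivative L) (at v) \<and> (\<forall>c v. L (c *s v) = c * L v)"
    by (intro exI conjI, rule has_derivative_coords[OF assms]) (use v in \<open>auto simp: algebra_simps\<close>)
qed

text \<open>Some component of the form is nonzero at the base point; where it stays nonzero, the
  equation of the plane can be solved for the corresponding component of the tangent vector.\<close>

lemma distribution_normal_form: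
  assumes "hol_hyperplane_distribution D"
  obtains i j k S a b where "UNIV = {i, j, k :: 3}" "i \<noteq> j" "i \<noteq> k" "j \<noteq> k"
    "hol3 a S" "hol3 b S" "(0, 0, 0) \<in> S"
    "\<And>q. q \<in> S \<Longrightarrow> D (chart p j k q) = {v. v $ i = a q * v $ j + b q * v $ k}"
proof -
  obtain V \<omega> where V: "open V" "p \<in> V" and \<omega>: "\<And>i. holo3 (\<lambda>x. \<omega> x $ i) V"
     and D: "\<And>x. x \<in> V \<Longrightarrow> \<omega> x \<noteq> 0 \<and> D x = {v. pair3 (\<omega> x) v = 0}"
    using assms unfolding hol_hyperplane_distribution_def by meson
  obtain i where i: "\<omega> p $ i \<noteq> 0" using D[OF V(2)] by (auto simp: vec_eq_iff)
  obtain j k where jk: "UNIV = {i, j, k :: 3}" "i \<noteq> j" "i \<noteq> k" "j \<noteq> k"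
  proof -
    consider "i = 1" | "i = 2" | "i = 3" using exhaust_3[of i] by blast
    then show thesis
    proof cases
      case 1 show thesis by (rule that[of 2 3]) (use 1 UNIV_3 in auto)
    next
      case 2 show thesis by (rule that[of 1 3]) (use 2 UNIV_3 in auto)
    next
      case 3 show thesis by (rule that[of 1 2]) (use 3 UNIV_3 in auto)
    qed
  qed
  define w where "w l q = \<omega> (chart p j k q) $ l" for l q
  have w: "hol3 (w l) (chart p j k -` V)" for l
    unfolding w_def[abs_def] by (rule hol3_chart[OF \<omega>])
  define S where "S = chart p j k -` V \<inter> w i -` (- {0})"
  have oS: "open S" unfolding S_def
    using hol3_continuous[OF w] hol3_open[OF w] by (intro continuous_open_preimage) auto
  have wS: "hol3 (w l) S" for l
    by (rule hol3_subset[OF w _ oS]) (auto simp: S_def)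
  have p: "chart p j k (0, 0, 0) = p" by (simp add: chart_def vec_eq_iff)
  show ?thesis
  \<comment> \<open>The minus sign is written as subtraction from 0 so that the closure rules for
    constants, differences and quotients apply directly.\<close>
  proof (rule that[OF jk, of "\<lambda>q. (0 - w j q) / w i q" S "\<lambda>q. (0 - w k q) / w i q"])
    show "hol3 (\<lambda>q. (0 - w j q) / w i q) S" "hol3 (\<lambda>q. (0 - w k q) / w i q) S"
      by (intro hol3_intros wS oS; simp add: S_def)+
    show "(0, 0, 0) \<in> S" using V i by (simp add: S_def p w_def)
    fix q assume q: "q \<in> S"
    have wq: "w i q \<noteq> 0" using q by (simp add: S_def)
    have "pair3 (\<omega> (chart p j k q)) v = w i q * v $ i + w j q * v $ j + w k q * v $ k" for v
      unfolding pair3_def jk(1) using jk(2-4) by (simp add: w_def)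
    also have "\<dots> v = w i q * (v $ i - ((0 - w j q) / w i q * v $ j + (0 - w k q) / w i q * v $ k))" for v
      using wq by (simp add: distrib_left right_diff_distrib)
    finally have "pair3 (\<omega> (chart p j k q)) v = 0 \<longleftrightarrow> v $ i = (0 - w j q) / w i q * v $ j + (0 - w k q) / w i q * v $ k" for v
      using wq by (simp only: mult_eq_0_iff simp_thms right_minus_eq)
    then show "D (chart p j k q) = {v. v $ i = (0 - w j q) / w i q * v $ j + (0 - w k q) / w i q * v $ k}"
      using D[of "chart p j k q"] q by (auto simp: S_def)
  qed
qed

text \<open>A preimage domain such as \<open>\<Omega>\<close> may be disconnected, whereas a curve
  needs a connected one. The component of 0 contains the whole segment, hence also the parameter
  1.\<close>

lemma reachable_in_segment:
  assumes "open \<Omega>" "complex_of_real ` {0..1} \<subseteq> \<Omega>"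
    and hol: "\<And>i. (\<lambda>t. \<gamma> t $ i) holomorphic_on \<Omega>"
    and U: "\<And>t. t \<in> \<Omega> \<Longrightarrow> \<gamma> t \<in> U" and D: "\<And>t. t \<in> \<Omega> \<Longrightarrow> curve_deriv \<gamma> t \<in> D (\<gamma> t)"
  shows "reachable_in D U (\<gamma> 0) (\<gamma> 1)"
proof -
  define C where "C = connected_component_set \<Omega> 0"
  have C: "open C" "connected C" "C \<subseteq> \<Omega>"
    using \<open>open \<Omega>\<close> by (auto simp: C_def open_connected_component connected_component_subset)
  have conn: "connected (complex_of_real ` {0..1})"
    by (intro connected_continuous_image continuous_intros) auto
  have 01: "0 \<in> complex_of_real ` {0..1}" "1 \<in> complex_of_real ` {0..1}"
    by (auto intro!: image_eqI[of _ _ 0] image_eqI[of _ _ 1])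
  then have "0 \<in> C" "1 \<in> C"
    using subsetD[OF connected_component_maximal[OF 01(1) conn assms(2)]] unfolding C_def by blast+
  then have "admissible D \<gamma> C"
    using C hol D by (auto simp: admissible_def hol_curve_def intro: holomorphic_on_subset)
  then show ?thesis
    unfolding reachable_in_def using C U \<open>0 \<in> C\<close> \<open>1 \<in> C\<close> by blast
qed

theorem mainTheorem1:
  fixes D :: "complex^3 \<Rightarrow> (complex^3) set"
  assumes "hol_hyperplane_distribution D"
    and "\<forall>p U. open U \<and> p \<in> U \<longrightarrow> (\<exists>q\<in>U. \<not> reachable_in D U p q)"
  shows "integrable_distribution D"
  unfolding integrable_distribution_def
proof
  fix p
  obtain i j k S a b where ijk: "UNIV = {i, j, k :: 3}" "i \<noteq> j" "i \<noteq> k" "j \<noteq> k"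
    and a: "hol3 a S" and b: "hol3 b S" and S0: "(0, 0, 0) \<in> S"
    and D: "\<And>q. q \<in> S \<Longrightarrow> D (chart p j k q) = {v. v $ i = a q * v $ j + b q * v $ k}"
    by (rule distribution_normal_form[OF assms(1), of p]) (rule that)
  obtain N V Z \<zeta> f where N: "open N" "(0, 0, 0) \<in> N" "hol3 Z N" "hol3 f N" "hol3 \<zeta> V"
    "\<And>x y z. (x, y, z) \<in> N \<Longrightarrow> (x, y, Z (x, y, z)) \<in> V \<inter> S"
    "\<And>x y z. (x, y, z) \<in> N \<Longrightarrow> \<zeta> (x, y, Z (x, y, z)) = z"
    "\<And>x y w. (x, y, w) \<in> V \<Longrightarrow> (x, y, \<zeta> (x, y, w)) \<in> N \<and> Z (x, y, \<zeta> (x, y, w)) = w"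
    "\<And>x y z. (x, y, z) \<in> N \<Longrightarrow> D2 Z (x, y, z) = b (x, y, Z (x, y, z))"
    "\<And>x y z. (x, y, z) \<in> N \<Longrightarrow> D1 Z (x, y, z) + D3 Z (x, y, z) * f (x, y, z) = a (x, y, Z (x, y, z))"
    "Z (0, 0, 0) = 0" "\<And>q. q \<in> N \<Longrightarrow> D3 Z q \<noteq> 0"
    by (rule straightening[OF a b S0]) (rule that)
  note NV = IntD1[OF N(6)] and NS = IntD2[OF N(6)]
  let ?K = "chart p j k" and ?Q = "coords p j k i"
  note KQ = chart_coords[OF ijk]
  obtain \<rho> where \<rho>: "\<rho> > 0" "polydisc \<rho> \<subseteq> N"
  proof -
    obtain \<rho> where "\<rho> > 0" "cball 0 \<rho> \<times> cball 0 \<rho> \<times> cball 0 \<rho> \<subseteq> N"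
      using open_polydisc[OF N(1,2)] by metis
    moreover have "polydisc \<rho> \<subseteq> cball 0 \<rho> \<times> cball 0 \<rho> \<times> cball 0 \<rho>" by auto
    ultimately show thesis using that by blast
  qed
  have D2f: "D2 f q = 0" if q: "q \<in> polydisc \<rho>" for q
  proof (rule ccontr)
    assume nz: "D2 f q \<noteq> 0"
    obtain x1 y1 z1 where q1: "q = (x1, y1, z1)" by (cases q)
    have qN: "(x1, y1, z1) \<in> N" using \<rho> q q1 by blast
    obtain w0 U where U: "open U" "w0 \<in> U" 
      "\<And>w. w \<in> U \<Longrightarrow> \<exists>x y z x' y' \<Omega>. open \<Omega> \<and> complex_of_real ` {0..1} \<subseteq> \<Omega> \<and> (x 0, y 0, z 0) = w0 \<and> (x 1, y 1, z 1) = w \<and>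
      (\<forall>t\<in>\<Omega>. (x t, y t, z t) \<in> U \<inter> S \<and> (x has_field_derivative x' t) (at t) \<and> (y has_field_derivative y' t) (at t) \<and>
        (z has_field_derivative a (x t, y t, z t) * x' t + b (x t, y t, z t) * y' t) (at t))"
      by (rule exists_reachable_neighbourhood[OF N(3,4,5) NV NS N(7,8,9,10) qN nz[unfolded q1]]) (assumption | rule that)+
    \<comment> \<open>The hypothesis is invoked at the centre \<open>?K w0\<close> of the contact
      coordinates, in general different from \<open>p\<close>, with the neighbourhood carried over
      from the local model.\<close>
    define U' where "U' = ?Q -` U"
    have "open U'" unfolding U'_def by (intro open_vimage U(1) continuous_on_coords)
    moreover have "?K w0 \<in> U'" using U(2) by (simp add: U'_def KQ)
    ultimately obtain v where v: "v \<in> U'" "\<not> reachable_in D U' (?K w0) v" using assms(2) by blast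
    obtain x y z x' y' \<Omega> where \<Omega>: "open \<Omega>" "complex_of_real ` {0..1} \<subseteq> \<Omega>" 
      and ends: "(x 0, y 0, z 0) = w0" "(x 1, y 1, z 1) = ?Q v" 
      and t: "\<And>t. t \<in> \<Omega> \<Longrightarrow> (x t, y t, z t) \<in> U \<inter> S" 
      "\<And>t. t \<in> \<Omega> \<Longrightarrow> (x has_field_derivative x' t) (at t)" 
      "\<And>t. t \<in> \<Omega> \<Longrightarrow> (y has_field_derivative y' t) (at t)"
      "\<And>t. t \<in> \<Omega> \<Longrightarrow> (z has_field_derivative a (x t, y t, z t) * x' t + b (x t, y t, z t) * y' t) (at t)"
      using U(3)[of "?Q v"] v(1) unfolding U'_def by blast
    define \<gamma> where "\<gamma> t = ?K (x t, y t, z t)" for t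
    have nth: "(\<lambda>t. \<gamma> t $ j) = (\<lambda>t. p $ j + x t)" "(\<lambda>t. \<gamma> t $ k) = (\<lambda>t. p $ k + y t)" "(\<lambda>t. \<gamma> t $ i) = (\<lambda>t. p $ i + z t)"
      using chart_nth[OF ijk(2,3,4)] by (auto simp: \<gamma>_def)
    have der: "((\<lambda>t. \<gamma> t $ j) has_field_derivative x' t) (at t)" "((\<lambda>t. \<gamma> t $ k) has_field_derivative y' t) (at t)"
       "((\<lambda>t. \<gamma> t $ i) has_field_derivative a (x t, y t, z t) * x' t + b (x t, y t, z t) * y' t) (at t)" if "t \<in> \<Omega>" for t
      unfolding nth using t(2-4)[OF that] by (auto intro!: derivative_eq_intros)
    have "reachable_in D U' (\<gamma> 0) (\<gamma> 1)"
    proof (rule reachable_in_segment[OF \<Omega>])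
      fix l :: 3
      have "l \<in> {i, j, k}" using ijk(1) by blast
      then have "\<exists>d. ((\<lambda>t. \<gamma> t $ l) has_field_derivative d) (at t)" if "t \<in> \<Omega>" for t
        using der[OF that] by blast
      then show "(\<lambda>t. \<gamma> t $ l) holomorphic_on \<Omega>"
        using \<Omega>(1) by (simp add: holomorphic_on_open)
    next
      fix s assume s: "s \<in> \<Omega>"
      show "\<gamma> s \<in> U'" using t(1)[OF s] by (simp add: U'_def \<gamma>_def KQ)
      show "curve_deriv \<gamma> s \<in> D (\<gamma> s)"
        using der[OF s, THEN DERIV_imp_deriv] D[of "(x s, y s, z s)"] t(1)[OF s]
        by (simp add: curve_deriv_def \<gamma>_def[of s])
    qed
    then show False using v(2) ends by (simp add: \<gamma>_def KQ)
  qed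
  obtain F T where F: "hol3 F T" "(0, 0, 0) \<in> T" "T \<subseteq> S"
    "\<And>w. w \<in> T \<Longrightarrow> D3 F w \<noteq> 0 \<and> D1 F w = - a w * D3 F w \<and> D2 F w = - b w * D3 F w"
    by (rule exists_first_integral[OF N(3,4) NS N(9,10,11,12) \<rho> D2f]) (assumption | rule that)+
  show "\<exists>V F. open V \<and> p \<in> V \<and> holo3 F V \<and>
        (\<forall>x\<in>V. \<exists>L. (F has_derivative L) (at x) \<and> (\<exists>v. L v \<noteq> 0) \<and> D x = {v. L v = 0})"
  proof (intro exI conjI ballI)
    show "holo3 (\<lambda>v. F (?Q v)) (?Q -` T)" by (rule holo3_coords[OF F(1)])
    then show "open (?Q -` T)" by (simp add: holo3_def)
    show "p \<in> ?Q -` T" using F(2) by (simp add: coords_def)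
    fix v assume v: "v \<in> ?Q -` T"
    then show "((\<lambda>v. F (?Q v)) has_derivative (\<lambda>h. D1 F (?Q v) * h $ j + D2 F (?Q v) * h $ k + D3 F (?Q v) * h $ i)) (at v)"
      using has_derivative_coords[OF F(1)] by simp
    \<comment> \<open>The differential of the first integral is a nonzero multiple of the normal
      form, so both have the same kernel; the unit vector in direction \<open>i\<close> lies outside
      it.\<close>
    have L: "D1 F (?Q v) * h $ j + D2 F (?Q v) * h $ k + D3 F (?Q v) * h $ i = D3 F (?Q v) * (h $ i - (a (?Q v) * h $ j + b (?Q v) * h $ k))" for h
      using F(4)[of "?Q v"] v by (simp add: algebra_simps)
    show "D1 F (?Q v) * (axis i 1 :: complex^3) $ j + D2 F (?Q v) * (axis i 1 :: complex^3) $ k + D3 F (?Q v) * (axis i 1 :: complex^3) $ i \<noteq> 0"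
      using F(4)[of "?Q v"] v ijk by (simp add: axis_def)
    show "D v = {h. D1 F (?Q v) * h $ j + D2 F (?Q v) * h $ k + D3 F (?Q v) * h $ i = 0}"
      unfolding L using D[of "?Q v"] F(3,4) v by (auto simp: KQ)
  qed
qed

end
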